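(* In any model filiform group $\mathbb{E}_n$ with $n\ge4$, the Carnot-Carathéodory distance is not differentiable at $\exp(X_2)$.
   Context: For $n\ge2$, the model filiform group $\mathbb{E}_n$ is the Carnot group (simply connected stratified nilpotent Lie group) of step $n-1$ whose Lie algebra has a basis $X_1,\dots,X_n$ with only non-vanishing bracket relations $[X_i,X_1]=X_{i+1}$ for $1<i<n$, with stratification $V_1=\mathrm{Span}\{X_1,X_2\}$ (the horizontal layer) and $V_i=\mathrm{Span}\{X_{i+1}\}$ for $1<i<n$. Elements of the Lie algebra are regarded as left-invariant vector fields. An absolutely continuous curve $\gamma:[a,b]\to\mathbb{E}_n$ is horizontal if $\gamma'(t)=u_1(t)X_1(\gamma(t))+u_2(t)X_2(\gamma(t))$ for a.e. $t$ with $u_1,u_2\in L^1[a,b]$; its length is $\int_a^b|u|$. The Carnot-Carathéodory (CC) distance $d(x,y)$ is the infimum of lengths of horizontal curves joining $x$ to $y$; differentiability of the CC distance refers to the function $d(x)=d(x,0)$, where $0$ is the identity. Dilations: $\delta_\lambda(\exp(\sum_iY_i))=\exp(\sum_i\lambda^iY_i)$ for $\lambda>0$, $Y_i\in V_i$. With $\mathbb{G}=\mathbb{E}_n$, $L:\mathbb{G}\to\mathbb{R}$ is $\mathbb{G}$-linear if $L(xy)=L(x)+L(y)$ and $L(\delta_\lambda(x))=\lambda L(x)$ for all $x,y\in\mathbb{G}$, $\lambda>0$. A map $f:\mathbb{G}\to\mathbb{R}$ is (Pansu) differentiable at $x$ if there is a $\mathbb{G}$-linear $L$ with $\lim_{y\to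 x}|f(y)-f(x)-L(x^{-1}y)|/d(x,y)=0$. *)

theory Defs
  imports "HOL-Analysis.Analysis" "HOL-Algebra.Group"
begin

section \<open>The model filiform group\<close>

text \<open>
  The simply connected Lie group with the given Lie algebra is unique up to isomorphism; it is
  realised here on \<open>\<real>\<^sup>n\<close>, as functions on \<open>nat\<close> supported on \<open>{1..n}\<close>, in exponential coordinates
  of the second kind: \<open>x\<close> stands for \<open>exp (x\<^sub>2 X\<^sub>2 + \<dots> + x\<^sub>n X\<^sub>n) exp (x\<^sub>1 X\<^sub>1)\<close>.  Since
  \<open>X\<^sub>2, \<dots>, X\<^sub>n\<close> commute, the product is
  \<open>exp (v) exp (a X\<^sub>1) exp (w) exp (b X\<^sub>1) = exp (v + exp (a ad X\<^sub>1) w) exp ((a + b) X\<^sub>1)\<close>,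
  where \<open>ad X\<^sub>1 (X\<^sub>i) = - X\<^sub>i\<^sub>+\<^sub>1\<close>.  The group axioms, the bracket relations and the bijectivity of
  the exponential map are proved below.
\<close>

definition filiform_coords :: "nat \<Rightarrow> (nat \<Rightarrow> real) set" where
  "filiform_coords n = {x. \<forall>i. i \<notin> {1..n} \<longrightarrow> x i = 0}"

definition filiform_mult :: "nat \<Rightarrow> (nat \<Rightarrow> real) \<Rightarrow> (nat \<Rightarrow> real) \<Rightarrow> (nat \<Rightarrow> real)" where
  "filiform_mult n x y = (\<lambda>i.
     if i = 1 then x 1 + y 1
     else if i \<in> {2..n} then x i + (\<Sum>k=2..i. (- x 1) ^ (i - k) / fact (i - k) * y k)
     else 0)"

definition filiform :: "nat \<Rightarrow> (nat \<Rightarrow> real) monoid" where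
  "filiform n = \<lparr>carrier = filiform_coords n, mult = filiform_mult n, one = (\<lambda>_. 0)\<rparr>"

definition unit_coord :: "nat \<Rightarrow> (nat \<Rightarrow> real)" where
  "unit_coord k = (\<lambda>i. if i = k then 1 else 0)"

text \<open>
  Vector fields are given by their components with respect to the coordinate fields.  The field
  \<open>X\<^sub>k\<close> is the left-invariant one that agrees at the identity with the \<open>k\<close>-th coordinate direction:
  its value at \<open>x\<close> is the image of that direction under the differential of left translation.
\<close>

definition filiform_X :: "nat \<Rightarrow> nat \<Rightarrow> (nat \<Rightarrow> real) \<Rightarrow> (nat \<Rightarrow> real)" where
  "filiform_X n k x = (\<lambda>j. deriv (\<lambda>s. (x \<otimes>\<^bsub>filiform n\<^esub> (\<lambda>i. s * unit_coord k i)) j) 0)"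

definition filiform_field :: "nat \<Rightarrow> (nat \<Rightarrow> real) \<Rightarrow> (nat \<Rightarrow> real) \<Rightarrow> (nat \<Rightarrow> real)" where
  "filiform_field n c x = (\<lambda>j. \<Sum>k=1..n. c k * filiform_X n k x j)"

definition lie_bracket ::
  "nat \<Rightarrow> ((nat \<Rightarrow> real) \<Rightarrow> (nat \<Rightarrow> real)) \<Rightarrow> ((nat \<Rightarrow> real) \<Rightarrow> (nat \<Rightarrow> real)) \<Rightarrow> (nat \<Rightarrow> real) \<Rightarrow> (nat \<Rightarrow> real)"
  where
  "lie_bracket n Y Z x = (\<lambda>j. \<Sum>i=1..n.
     Y x i * deriv (\<lambda>s. Z (x(i := s)) j) (x i) - Z x i * deriv (\<lambda>s. Y (x(i := s)) j) (x i))"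

text \<open>
  An element of the Lie algebra is represented by its coefficients \<open>c\<close> with respect to
  \<open>X\<^sub>1, \<dots>, X\<^sub>n\<close>.  Its exponential is the value at time 1 of the integral curve through the identity.
\<close>

definition filiform_exp :: "nat \<Rightarrow> (nat \<Rightarrow> real) \<Rightarrow> (nat \<Rightarrow> real)" where
  "filiform_exp n c = (THE p. \<exists>\<gamma> :: real \<Rightarrow> nat \<Rightarrow> real.
     (\<forall>t. \<gamma> t \<in> carrier (filiform n)) \<and> \<gamma> 0 = \<one>\<^bsub>filiform n\<^esub> \<and> \<gamma> 1 = p \<and>
     (\<forall>t j. ((\<lambda>s. \<gamma> s j) has_real_derivative filiform_field n c (\<gamma> t) j) (at t)))"

text \<open>The layer of the stratification that contains \<open>X\<^sub>k\<close>.\<close>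

definition filiform_layer :: "nat \<Rightarrow> nat" where
  "filiform_layer k = (if k = 1 then 1 else k - 1)"

definition filiform_dilation :: "nat \<Rightarrow> real \<Rightarrow> (nat \<Rightarrow> real) \<Rightarrow> (nat \<Rightarrow> real)" where
  "filiform_dilation n r x =
     filiform_exp n (\<lambda>k. r ^ filiform_layer k * inv_into (filiform_coords n) (filiform_exp n) x k)"

section \<open>The Carnot-Caratheodory distance\<close>

definition absolutely_continuous_on :: "real \<Rightarrow> real \<Rightarrow> (real \<Rightarrow> real) \<Rightarrow> bool" where
  "absolutely_continuous_on a b f \<longleftrightarrow>
     (\<forall>\<epsilon>>0. \<exists>\<delta>>0. \<forall>D :: (real \<times> real) set.
        finite D \<and> (\<forall>(s, t)\<in>D. a \<le> s \<and> s < t \<and> t \<le> b) \<and>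
        pairwise (\<lambda>p q. disjnt {fst p<..<snd p} {fst q<..<snd q}) D \<and>
        (\<Sum>(s, t)\<in>D. t - s) < \<delta> \<longrightarrow>
        (\<Sum>(s, t)\<in>D. \<bar>f t - f s\<bar>) < \<epsilon>)"

text \<open>\<open>\<gamma>\<close> is a horizontal curve on \<open>[a, b]\<close> with controls \<open>u\<^sub>1\<close> and \<open>u\<^sub>2\<close>.\<close>

definition horizontal_curve ::
  "nat \<Rightarrow> real \<Rightarrow> real \<Rightarrow> (real \<Rightarrow> nat \<Rightarrow> real) \<Rightarrow> (real \<Rightarrow> real) \<Rightarrow> (real \<Rightarrow> real) \<Rightarrow> bool" where
  "horizontal_curve n a b \<gamma> u1 u2 \<longleftrightarrow>
     (\<forall>t\<in>{a..b}. \<gamma> t \<in> carrier (filiform n)) \<and>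
     (\<forall>j. absolutely_continuous_on a b (\<lambda>t. \<gamma> t j)) \<and>
     u1 absolutely_integrable_on {a..b} \<and> u2 absolutely_integrable_on {a..b} \<and>
     (AE t in lebesgue_on {a..b}. \<forall>j.
        ((\<lambda>s. \<gamma> s j) has_real_derivative
           u1 t * filiform_X n 1 (\<gamma> t) j + u2 t * filiform_X n 2 (\<gamma> t) j) (at t within {a..b}))"

definition control_length :: "real \<Rightarrow> real \<Rightarrow> (real \<Rightarrow> real) \<Rightarrow> (real \<Rightarrow> real) \<Rightarrow> real" where
  "control_length a b u1 u2 = integral {a..b} (\<lambda>t. sqrt ((u1 t)\<^sup>2 + (u2 t)\<^sup>2))"

text \<open>
  The infimum is a real one.  It is never taken over the empty set on the carrier, because any two
  points are joined by a horizontal curve (\<open>X\<^sub>1\<close> and \<open>X\<^sub>2\<close> generate the Lie algebra).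
\<close>

definition cc_dist :: "nat \<Rightarrow> (nat \<Rightarrow> real) \<Rightarrow> (nat \<Rightarrow> real) \<Rightarrow> real" where
  "cc_dist n x y = Inf {control_length a b u1 u2 | a b \<gamma> u1 u2.
     a < b \<and> horizontal_curve n a b \<gamma> u1 u2 \<and> \<gamma> a = x \<and> \<gamma> b = y}"

section \<open>Pansu differentiability\<close>

definition filiform_linear :: "nat \<Rightarrow> ((nat \<Rightarrow> real) \<Rightarrow> real) \<Rightarrow> bool" where
  "filiform_linear n L \<longleftrightarrow>
     (\<forall>x\<in>carrier (filiform n). \<forall>y\<in>carrier (filiform n). L (x \<otimes>\<^bsub>filiform n\<^esub> y) = L x + L y) \<and>
     (\<forall>x\<in>carrier (filiform n). \<forall>r>0. L (filiform_dilation n r x) = r * L x)"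

text \<open>
  The limit is taken in the product topology on \<open>nat \<Rightarrow> real\<close>, which induces on the carrier the
  Euclidean topology of \<open>\<real>\<^sup>n\<close>, that is, the manifold topology of the group.
\<close>

definition pansu_differentiable_at :: "nat \<Rightarrow> ((nat \<Rightarrow> real) \<Rightarrow> real) \<Rightarrow> (nat \<Rightarrow> real) \<Rightarrow> bool" where
  "pansu_differentiable_at n f x \<longleftrightarrow>
     (\<exists>L. filiform_linear n L \<and>
        ((\<lambda>y. \<bar>f y - f x - L (inv\<^bsub>filiform n\<^esub> x \<otimes>\<^bsub>filiform n\<^esub> y)\<bar> / cc_dist n x y) \<longlongrightarrow> 0)
          (at x within carrier (filiform n)))"

section \<open>Correctness of the coordinate model\<close>

lemma filiform_simps [simp]:
  "carrier (filiform n) = filiform_coords n"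
  "x \<otimes>\<^bsub>filiform n\<^esub> y = filiform_mult n x y"
  "\<one>\<^bsub>filiform n\<^esub> = (\<lambda>_. 0)"
  by (simp_all add: filiform_def)

lemma exp_coeff_add:
  fixes a b :: real
  assumes "k \<le> i"
  shows "(\<Sum>j=k..i. a ^ (i - j) / fact (i - j) * (b ^ (j - k) / fact (j - k)))
         = (a + b) ^ (i - k) / fact (i - k)"
proof -
  define m where "m = i - k"
  have "(\<Sum>j=k..i. a ^ (i - j) / fact (i - j) * (b ^ (j - k) / fact (j - k)))
      = (\<Sum>j=0..m. a ^ (m - j) / fact (m - j) * (b ^ j / fact j))"
    unfolding m_def using assms by (subst sum.atLeastAtMost_shift_0) simp_all
  also have "\<dots> = (\<Sum>j\<le>m. (of_nat (m choose j) * b ^ j * a ^ (m - j)) / fact m)"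
    by (rule sum.cong) (auto simp: binomial_fact field_simps)
  also have "\<dots> = (b + a) ^ m / fact m"
    by (simp add: binomial_ring sum_divide_distrib)
  finally show ?thesis by (simp add: m_def add.commute)
qed

lemma filiform_mult_closed:
  assumes "1 \<le> n" shows "filiform_mult n x y \<in> filiform_coords n"
  using assms by (auto simp: filiform_coords_def filiform_mult_def)

lemma sum_triangle_swap:
  fixes g :: "nat \<Rightarrow> nat \<Rightarrow> real"
  shows "(\<Sum>k=m..i. \<Sum>l=m..k. g k l) = (\<Sum>l=m..i. \<Sum>k=l..i. g k l)"
proof -
  have "(\<Sum>k=m..i. \<Sum>l=m..k. g k l) = (\<Sum>k\<in>{m..i}. \<Sum>l\<in>{l\<in>{m..i}. l \<le> k}. g k l)"
    by (intro sum.cong) auto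
  also have "\<dots> = (\<Sum>l\<in>{m..i}. \<Sum>k\<in>{k\<in>{m..i}. l \<le> k}. g k l)"
    by (rule sum.swap_restrict) auto
  also have "\<dots> = (\<Sum>l=m..i. \<Sum>k=l..i. g k l)"
    by (intro sum.cong) auto
  finally show ?thesis .
qed

lemma filiform_mult_assoc:
  "filiform_mult n (filiform_mult n x y) z = filiform_mult n x (filiform_mult n y z)"
proof
  fix i
  show "filiform_mult n (filiform_mult n x y) z i = filiform_mult n x (filiform_mult n y z) i"
  proof (cases "i \<in> {2..n}")
    case True
    let ?e = "\<lambda>a i k. (- a) ^ (i - k) / fact (i - k) :: real"
    have "(\<Sum>k=2..i. ?e (x 1) i k * filiform_mult n y z k)
        = (\<Sum>k=2..i. ?e (x 1) i k * y k) + (\<Sum>k=2..i. \<Sum>l=2..k. ?e (x 1) i k * (?e (y 1) k l * z l))"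
      using True by (simp add: filiform_mult_def sum.distrib distrib_left sum_distrib_left)
    also have "(\<Sum>k=2..i. \<Sum>l=2..k. ?e (x 1) i k * (?e (y 1) k l * z l))
        = (\<Sum>l=2..i. (\<Sum>k=l..i. ?e (x 1) i k * ?e (y 1) k l) * z l)"
      by (simp add: sum_triangle_swap sum_distrib_right mult.assoc)
    also have "\<dots> = (\<Sum>l=2..i. ?e (x 1 + y 1) i l * z l)"
    proof (intro sum.cong refl)
      fix l assume "l \<in> {2..i}"
      then have "(\<Sum>k=l..i. ?e (x 1) i k * ?e (y 1) k l) = ?e (x 1 + y 1) i l"
        using exp_coeff_add [of l i "- x 1" "- y 1"] by (simp only: minus_add_distrib atLeastAtMost_iff)
      then show "(\<Sum>k=l..i. ?e (x 1) i k * ?e (y 1) k l) * z l = ?e (x 1 + y 1) i l * z l"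
        by (simp only:)
    qed
    finally show ?thesis
      using True by (simp add: filiform_mult_def)
  next
    case False
    then show ?thesis
      by (cases "i = 1") (simp_all add: filiform_mult_def del: atLeastAtMost_iff)
  qed
qed

lemma sum_diag_eq:
  fixes g :: "nat \<Rightarrow> real"
  assumes "m \<le> i"
  shows "(\<Sum>k=m..i. 0 ^ (i - k) * g k / fact (i - k)) = g i"
proof -
  have "(\<Sum>k=m..i. 0 ^ (i - k) * g k / fact (i - k)) = (\<Sum>k=m..i. if k = i then g k else 0)"
    by (intro sum.cong) (auto simp: power_0_left)
  also have "\<dots> = g i" using assms by simp
  finally show ?thesis .
qed

lemma filiform_group:
  assumes "1 \<le> n" shows "group (filiform n)"
proof (rule groupI)
  fix x assume x: "x \<in> carrier (filiform n)"
  show "\<one>\<^bsub>filiform n\<^esub> \<otimes>\<^bsub>filiform n\<^esub> x = x"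
    using x by (auto simp: filiform_mult_def fun_eq_iff filiform_coords_def sum_diag_eq)
  let ?y = "\<lambda>i. if i = 1 then - x 1
     else if i \<in> {2..n} then - (\<Sum>k=2..i. (x 1) ^ (i - k) / fact (i - k) * x k) else 0"
  have "?y \<in> carrier (filiform n)"
    using assms by (auto simp: filiform_coords_def)
  moreover have "?y \<otimes>\<^bsub>filiform n\<^esub> x = \<one>\<^bsub>filiform n\<^esub>"
    by (simp add: filiform_mult_def fun_eq_iff)
  ultimately show "\<exists>y\<in>carrier (filiform n). y \<otimes>\<^bsub>filiform n\<^esub> x = \<one>\<^bsub>filiform n\<^esub>"
    by (intro bexI [where x = ?y])
next
  show "\<one>\<^bsub>filiform n\<^esub> \<in> carrier (filiform n)"
    by (simp add: filiform_coords_def)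
qed (simp_all add: filiform_mult_closed [OF assms] filiform_mult_assoc)

lemma filiform_X_one:
  "filiform_X n 1 x = unit_coord 1"
proof
  fix j
  have "filiform_mult n x (\<lambda>i. s * unit_coord 1 i) j
      = (if j = 1 then x 1 + s else if j \<in> {2..n} then x j else 0)" for s
    by (auto simp: filiform_mult_def unit_coord_def)
  then show "filiform_X n 1 x j = unit_coord 1 j"
    by (auto simp: filiform_X_def unit_coord_def intro!: DERIV_imp_deriv derivative_eq_intros)
qed

lemma filiform_X_formula:
  assumes "2 \<le> k"
  shows "filiform_X n k x =
    (\<lambda>j. if k \<le> j \<and> j \<le> n then (- x 1) ^ (j - k) / fact (j - k) else 0)"
proof
  fix j
  let ?a = "if j = 1 then x 1 else if j \<in> {2..n} then x j else 0"
  let ?b = "if k \<le> j \<and> j \<le> n then (- x 1) ^ (j - k) / fact (j - k) else 0"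
  have "filiform_mult n x (\<lambda>i. s * unit_coord k i) j = ?a + s * ?b" for s
  proof -
    have "(\<Sum>l=2..j. (- x 1) ^ (j - l) / fact (j - l) * (s * unit_coord k l))
        = (\<Sum>l=2..j. if l = k then (- x 1) ^ (j - l) / fact (j - l) * s else 0)"
      by (intro sum.cong) (auto simp: unit_coord_def)
    then show ?thesis
      using assms by (auto simp: filiform_mult_def unit_coord_def)
  qed
  moreover have "((\<lambda>s. ?a + s * ?b) has_real_derivative ?b) (at 0)"
    by (rule derivative_eq_intros refl | simp)+
  ultimately show "filiform_X n k x j = ?b"
    by (simp add: filiform_X_def DERIV_imp_deriv)
qed

text \<open>The only non-vanishing brackets are \<open>[X\<^sub>i, X\<^sub>1] = X\<^sub>i\<^sub>+\<^sub>1\<close> for \<open>1 < i < n\<close>.\<close>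

lemma filiform_bracket_X_one:
  assumes "1 < i" "i \<le> n"
  shows "lie_bracket n (filiform_X n i) (filiform_X n 1) x =
    (if i < n then filiform_X n (i + 1) x else (\<lambda>_. 0))"
proof
  fix j
  have d: "deriv (\<lambda>s. filiform_X n i (x(1 := s)) j) (x 1)
      = (if i + 1 \<le> j \<and> j \<le> n then - ((- x 1) ^ (j - (i + 1)) / fact (j - (i + 1))) else 0)"
  proof (cases "i + 1 \<le> j \<and> j \<le> n")
    case True
    then obtain m where m: "j - i = Suc m" by (metis Suc_diff_le Suc_eq_plus1 diff_Suc_Suc)
    then have m': "j - Suc i = m" by simp
    have "((\<lambda>s. (- s) ^ Suc m / fact (Suc m)) has_real_derivative - ((- x 1) ^ m / fact m)) (at (x 1))"
      by (rule derivative_eq_intros refl | simp)+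
    then show ?thesis
      using True assms m m' by (simp add: filiform_X_formula DERIV_imp_deriv del: power_Suc fact_Suc)
  next
    case False
    then have "i = j \<or> \<not> (i \<le> j \<and> j \<le> n)" by linarith
    then show ?thesis using assms False by (auto simp: filiform_X_formula)
  qed
  have "lie_bracket n (filiform_X n i) (filiform_X n 1) x j
      = (\<Sum>l=1..n. if l = 1 then - deriv (\<lambda>s. filiform_X n i (x(1 := s)) j) (x 1) else 0)"
    unfolding lie_bracket_def filiform_X_one by (intro sum.cong) (auto simp: unit_coord_def)
  also have "\<dots> = - deriv (\<lambda>s. filiform_X n i (x(1 := s)) j) (x 1)"
    using assms by simp
  finally show "lie_bracket n (filiform_X n i) (filiform_X n 1) x j =
    (if i < n then filiform_X n (i + 1) x else (\<lambda>_. 0)) j"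
    unfolding d using assms by (auto simp: filiform_X_formula)
qed

lemma filiform_bracket_vanish:
  assumes "1 < i" "1 < k"
  shows "lie_bracket n (filiform_X n i) (filiform_X n k) x = (\<lambda>_. 0)"
proof
  fix j
  have vanish: "filiform_X n a x l * deriv (\<lambda>s. filiform_X n b (x(l := s)) j) (x l) = 0"
    if "1 < a" "1 < b" for a b l
  proof (cases "l = 1")
    case False
    then have "(\<lambda>s. filiform_X n b (x(l := s)) j) = (\<lambda>s. filiform_X n b x j)"
      using that by (auto simp: filiform_X_formula)
    then show ?thesis by simp
  qed (use that in \<open>simp add: filiform_X_formula\<close>)
  show "lie_bracket n (filiform_X n i) (filiform_X n k) x j = 0"
    unfolding lie_bracket_def
    by (intro sum.neutral ballI) (simp only: vanish [OF assms] vanish [OF assms(2,1)] diff_self)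
qed

lemma filiform_field_formula:
  assumes "1 \<le> n"
  shows "filiform_field n c x j = (if j = 1 then c 1 else
     if j \<in> {2..n} then (\<Sum>k=2..j. c k * ((- x 1) ^ (j - k) / fact (j - k))) else 0)"
proof -
  have "filiform_field n c x j = c 1 * unit_coord 1 j + (\<Sum>k=2..n. c k * filiform_X n k x j)"
    using assms unfolding filiform_field_def
    by (subst sum.atLeast_Suc_atMost) (simp_all add: filiform_X_one [simplified] numeral_2_eq_2)
  also have "(\<Sum>k=2..n. c k * filiform_X n k x j) = (\<Sum>k=2..n. if k \<le> j \<and> j \<le> n then
      c k * ((- x 1) ^ (j - k) / fact (j - k)) else 0)"
    by (intro sum.cong) (auto simp: filiform_X_formula)
  also have "\<dots> = (if j \<in> {2..n} then (\<Sum>k=2..j. c k * ((- x 1) ^ (j - k) / fact (j - k))) else 0)"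
    (is "?L = ?R")
  proof (cases "j \<in> {2..n}")
    case True
    have "?L = (\<Sum>k\<in>{2..n} \<inter> {k. k \<le> j \<and> j \<le> n}. c k * ((- x 1) ^ (j - k) / fact (j - k)))"
      by (simp only: sum.inter_restrict finite_atLeastAtMost mem_Collect_eq)
    also have "{2..n} \<inter> {k. k \<le> j \<and> j \<le> n} = {2..j}" using True by auto
    finally show ?thesis using True by simp
  qed (auto intro!: sum.neutral)
  finally show ?thesis by (auto simp: unit_coord_def)
qed

lemma filiform_exp_formula:
  assumes "1 \<le> n"
  shows "filiform_exp n c = (\<lambda>j. if j = 1 then c 1 else
     if j \<in> {2..n} then (\<Sum>k=2..j. c k * ((- c 1) ^ (j - k) / fact (j - k + 1))) else 0)"
proof -
  define \<sigma> :: "real \<Rightarrow> nat \<Rightarrow> real" where "\<sigma> t j = (if j = 1 then t * c 1 else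
     if j \<in> {2..n} then
       (\<Sum>k=2..j. c k * ((- c 1) ^ (j - k) * t ^ (j - k + 1) / fact (j - k + 1))) else 0)" for t j
  define C where "C \<gamma> p \<longleftrightarrow>
     (\<forall>t. \<gamma> t \<in> carrier (filiform n)) \<and> \<gamma> 0 = \<one>\<^bsub>filiform n\<^esub> \<and> \<gamma> 1 = p \<and>
     (\<forall>t j. ((\<lambda>s. \<gamma> s j) has_real_derivative filiform_field n c (\<gamma> t) j) (at t))" for \<gamma> p
  have pow: "((\<lambda>s. s ^ Suc m / fact (Suc m)) has_real_derivative t ^ m / fact m) (at t)"
    for m and t :: real
    by (rule derivative_eq_intros refl | simp)+
  have d\<sigma>: "((\<lambda>s. \<sigma> s j) has_real_derivative filiform_field n c (\<sigma> t) j) (at t)" for t j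
  proof -
    consider "j = 1" | "j \<in> {2..n}" | "j \<noteq> 1" "j \<notin> {2..n}" by blast
    then show ?thesis
    proof cases
      case 1
      then show ?thesis using assms
        by (auto simp: filiform_field_formula \<sigma>_def intro!: derivative_eq_intros)
    next
      case 2
      have "((\<lambda>s. \<Sum>k=2..j. c k * (- c 1) ^ (j - k) * (s ^ Suc (j - k) / fact (Suc (j - k))))
          has_real_derivative (\<Sum>k=2..j. c k * (- c 1) ^ (j - k) * (t ^ (j - k) / fact (j - k)))) (at t)"
        by (intro DERIV_sum DERIV_cmult pow)
      moreover have "(\<lambda>s. \<sigma> s j) =
          (\<lambda>s. \<Sum>k=2..j. c k * (- c 1) ^ (j - k) * (s ^ Suc (j - k) / fact (Suc (j - k))))"
        using 2 by (simp add: \<sigma>_def mult.assoc)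
      moreover have "filiform_field n c (\<sigma> t) j =
          (\<Sum>k=2..j. c k * (- c 1) ^ (j - k) * (t ^ (j - k) / fact (j - k)))"
      proof -
        have "(- \<sigma> t 1) ^ m = (- c 1) ^ m * t ^ m" for m
          unfolding \<sigma>_def by (subst power_mult_distrib [symmetric]) (simp add: mult.commute)
        then show ?thesis using 2 assms by (simp add: filiform_field_formula mult.assoc)
      qed
      ultimately show ?thesis by simp
    next
      case 3
      then show ?thesis using assms by (auto simp: filiform_field_formula \<sigma>_def)
    qed
  qed
  have "\<sigma> t \<in> filiform_coords n" for t
    using assms by (auto simp: filiform_coords_def \<sigma>_def)
  moreover have \<sigma>0: "\<sigma> 0 = (\<lambda>_. 0)"
    by (simp add: fun_eq_iff \<sigma>_def)
  ultimately have C\<sigma>: "C \<sigma> (\<sigma> 1)"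
    using d\<sigma> unfolding C_def filiform_simps by blast
  have uniq: "\<gamma> t j = \<sigma> t j" if "C \<gamma> p" for \<gamma> p t j
  proof -
    have \<gamma>0: "\<gamma> 0 = (\<lambda>_. 0)"
      and d\<gamma>: "((\<lambda>s. \<gamma> s j) has_real_derivative filiform_field n c (\<gamma> t) j) (at t)" for t j
      using that unfolding C_def filiform_simps by blast+
    have eqI: "\<gamma> t j = \<sigma> t j" if "\<And>t. filiform_field n c (\<gamma> t) j = filiform_field n c (\<sigma> t) j" for t j
    proof -
      have "((\<lambda>s. \<gamma> s j - \<sigma> s j) has_real_derivative 0) (at s)" for s
        using DERIV_diff [OF d\<gamma> [of j s] d\<sigma> [of j s]] that by simp
      then have "\<gamma> t j - \<sigma> t j = \<gamma> 0 j - \<sigma> 0 j" by (intro DERIV_isconst_all) auto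
      then show ?thesis by (simp add: \<gamma>0 \<sigma>0)
    qed
    have "\<gamma> t 1 = \<sigma> t 1" for t
      by (rule eqI) (simp add: filiform_field_formula [OF assms])
    then show ?thesis
      by (intro eqI) (simp add: filiform_field_formula [OF assms])
  qed
  have "filiform_exp n c = (THE p. \<exists>\<gamma>. C \<gamma> p)"
    unfolding filiform_exp_def C_def ..
  also have "\<dots> = \<sigma> 1"
  proof (rule the_equality)
    fix p assume "\<exists>\<gamma>. C \<gamma> p"
    then obtain \<gamma> where \<gamma>: "C \<gamma> p" ..
    then have "\<gamma> 1 = p" by (simp add: C_def)
    then show "p = \<sigma> 1" using uniq [OF \<gamma>] by auto
  qed (use C\<sigma> in blast)
  finally show ?thesis by (simp add: \<sigma>_def fun_eq_iff)
qed

lemma filiform_exp_bij: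
  assumes "1 \<le> n"
  shows "bij_betw (filiform_exp n) (filiform_coords n) (filiform_coords n)"
proof (rule bij_betw_imageI)
  let ?r = "\<lambda>c j. \<Sum>k=2..<j. c k * ((- c 1) ^ (j - k) / fact (j - k + 1)) :: real"
  have step: "filiform_exp n c j = ?r c j + c j" if "j \<in> {2..n}" for c j
  proof -
    have "{2..j} = insert j {2..<j}" using that by auto
    then show ?thesis using that assms by (simp add: filiform_exp_formula)
  qed
  show "inj_on (filiform_exp n) (filiform_coords n)"
  proof (rule inj_onI)
    fix c d assume cd: "c \<in> filiform_coords n" "d \<in> filiform_coords n"
      and eq: "filiform_exp n c = filiform_exp n d"
    have one: "c 1 = d 1"
      using fun_cong [OF eq, of 1] assms by (simp add: filiform_exp_formula)
    have "c j = d j" for j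
    proof (induction j rule: less_induct)
      case (less j)
      consider "j = 1" | "j \<in> {2..n}" | "j \<noteq> 1" "j \<notin> {2..n}" by blast
      then show ?case
      proof cases
        case 2
        have "?r c j = ?r d j" using less one by (intro sum.cong) auto
        then show ?thesis using step [OF 2] fun_cong [OF eq, of j] by simp
      qed (use one cd in \<open>auto simp: filiform_coords_def\<close>)
    qed
    then show "c = d" by auto
  qed
  have closed: "filiform_exp n c \<in> filiform_coords n" for c
    using assms by (auto simp: filiform_exp_formula filiform_coords_def)
  have "\<exists>c\<in>filiform_coords n. c 1 = x 1 \<and> (\<forall>j\<in>{2..n}. j \<le> m \<longrightarrow> filiform_exp n c j = x j)"
    for x m
  proof (induction m)
    case 0
    show ?case
      using assms by (intro bexI [of _ "\<lambda>i. if i = 1 then x 1 else 0"]) (auto simp: filiform_coords_def)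
  next
    case (Suc m)
    then obtain c where c: "c \<in> filiform_coords n" "c 1 = x 1"
      and ih: "\<And>j. j \<in> {2..n} \<Longrightarrow> j \<le> m \<Longrightarrow> filiform_exp n c j = x j" by blast
    show ?case
    proof (cases "Suc m \<in> {2..n}")
      case True
      define d where "d = c(Suc m := x (Suc m) - ?r c (Suc m))"
      have rd: "?r d j = ?r c j" if "j \<le> Suc m" for j
        using that True by (intro sum.cong) (auto simp: d_def)
      have "filiform_exp n d j = x j" if "j \<in> {2..n}" "j \<le> Suc m" for j
      proof (cases "j = Suc m")
        case True
        have "filiform_exp n d j = ?r c j + d j"
          using step [OF that(1)] rd [OF that(2)] by simp
        then show ?thesis using True by (simp add: d_def)
      next
        case False
        then have "filiform_exp n d j = filiform_exp n c j"
          using step [OF that(1)] rd [OF that(2)] by (simp add: d_def)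
        then show ?thesis using ih that False by simp
      qed
      moreover have "d \<in> filiform_coords n" "d 1 = x 1"
        using c True by (auto simp: d_def filiform_coords_def)
      ultimately show ?thesis by blast
    next
      case False
      then show ?thesis using c ih by (intro bexI [of _ c]) (auto simp: le_Suc_eq)
    qed
  qed
  note ex = this
  show "filiform_exp n ` filiform_coords n = filiform_coords n"
  proof (intro equalityI subsetI)
    fix x assume x: "x \<in> filiform_coords n"
    obtain c where c: "c \<in> filiform_coords n" "c 1 = x 1"
      "\<And>j. j \<in> {2..n} \<Longrightarrow> filiform_exp n c j = x j"
      using ex [of x n] by auto
    have "filiform_exp n c j = x j" for j
    proof (cases "j \<in> {2..n}")
      case False
      then show ?thesis using c(2) x assms
        by (auto simp: filiform_exp_formula filiform_coords_def)
    qed (use c in auto)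
    then show "x \<in> filiform_exp n ` filiform_coords n"
      using c(1) by (auto simp: fun_eq_iff intro!: image_eqI [of _ _ c])
  qed (use closed in auto)
qed

lemma filiform_dilation_formula:
  assumes "1 \<le> n" and x: "x \<in> filiform_coords n"
  shows "filiform_dilation n r x = (\<lambda>j. r ^ filiform_layer j * x j)"
proof
  fix j
  define c where "c = inv_into (filiform_coords n) (filiform_exp n) x"
  have xc: "x = filiform_exp n c"
    unfolding c_def using filiform_exp_bij [OF assms(1)] x
    by (metis bij_betw_imp_surj_on f_inv_into_f)
  have "(- (r * c 1)) ^ (j - k) * r ^ (k - 1) = r ^ (j - 1) * (- c 1) ^ (j - k)"
    if "k \<in> {2..j}" for k
  proof -
    have "j - 1 = (j - k) + (k - 1)" using that by auto
    then have "r ^ (j - 1) = r ^ (j - k) * r ^ (k - 1)" by (metis power_add)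
    moreover have "(- (r * c 1)) ^ (j - k) = r ^ (j - k) * (- c 1) ^ (j - k)"
      by (simp add: power_mult_distrib [symmetric])
    ultimately show ?thesis by simp
  qed
  note p = this
  have "(\<Sum>k=2..j. r ^ (k - 1) * c k * ((- (r * c 1)) ^ (j - k) / fact (j - k + 1)))
      = r ^ (j - 1) * (\<Sum>k=2..j. c k * ((- c 1) ^ (j - k) / fact (j - k + 1)))"
    unfolding sum_distrib_left
  proof (intro sum.cong refl)
    fix k assume k: "k \<in> {2..j}"
    have "r ^ (k - 1) * c k * ((- (r * c 1)) ^ (j - k) / fact (j - k + 1))
        = c k * (((- (r * c 1)) ^ (j - k) * r ^ (k - 1)) / fact (j - k + 1))" by simp
    also have "\<dots> = r ^ (j - 1) * (c k * ((- c 1) ^ (j - k) / fact (j - k + 1)))"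
      unfolding p [OF k] by simp
    finally show "r ^ (k - 1) * c k * ((- (r * c 1)) ^ (j - k) / fact (j - k + 1))
        = r ^ (j - 1) * (c k * ((- c 1) ^ (j - k) / fact (j - k + 1)))" .
  qed
  then show "filiform_dilation n r x j = r ^ filiform_layer j * x j"
    unfolding filiform_dilation_def c_def [symmetric] using assms
    by (auto simp: xc filiform_exp_formula filiform_layer_def)
qed

text \<open>The coordinates are those of the second kind.\<close>

lemma filiform_second_kind:
  assumes "1 \<le> n" "x \<in> filiform_coords n"
  shows "x = filiform_exp n (x(1 := 0)) \<otimes>\<^bsub>filiform n\<^esub> filiform_exp n (\<lambda>i. x 1 * unit_coord 1 i)"
proof
  fix i
  have "(\<Sum>k=2..i. x k * (0 ^ (i - k) / fact (i - k + 1))) = x i" if "2 \<le> i"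
  proof -
    have "(\<Sum>k=2..i. x k * (0 ^ (i - k) / fact (i - k + 1))) = (\<Sum>k=2..i. if k = i then x k else 0)"
      by (intro sum.cong) (auto simp: power_0_left)
    then show ?thesis using that by simp
  qed
  moreover have "(\<Sum>k=2..i. (x(1 := 0)) k * (0 ^ (i - k) / fact (i - k + 1)))
      = (\<Sum>k=2..i. x k * (0 ^ (i - k) / fact (i - k + 1)))"
    by (intro sum.cong) auto
  moreover have "filiform_exp n (\<lambda>i. x 1 * unit_coord 1 i) = (\<lambda>i. x 1 * unit_coord 1 i)"
    using assms by (auto simp: filiform_exp_formula unit_coord_def fun_eq_iff intro!: sum.neutral)
  ultimately show "x i = (filiform_exp n (x(1 := 0)) \<otimes>\<^bsub>filiform n\<^esub>
      filiform_exp n (\<lambda>i. x 1 * unit_coord 1 i)) i"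
    using assms by (auto simp: filiform_mult_def filiform_exp_formula unit_coord_def filiform_coords_def
        intro!: sum.neutral)
qed

end

theory Submission
  imports Defs
begin

text \<open>
  The coordinates of a horizontal curve satisfy \<open>x\<^sub>1' = u\<^sub>1\<close>, \<open>x\<^sub>2' = u\<^sub>2\<close> and
  \<open>x\<^sub>4' = u\<^sub>2 x\<^sub>1\<^sup>2 / 2\<close>, so \<open>x\<^sub>4\<close> decreases only where \<open>u\<^sub>2 < 0\<close> and \<open>x\<^sub>1 \<noteq> 0\<close>.  The straight segment
  from the identity to \<open>p = exp (X\<^sub>2)\<close> has \<open>u\<^sub>2 > 0\<close> and \<open>x\<^sub>1 = 0\<close>; to arrive instead at a point with
  \<open>x\<^sub>1 = 0\<close>, \<open>x\<^sub>2 = 1\<close> and negative \<open>x\<^sub>4\<close>, a curve must leave the hyperplane \<open>x\<^sub>1 = 0\<close> and move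
  against \<open>X\<^sub>2\<close> there.  This has a price of first order:
  if \<open>x\<^sub>4 = - t\<^sup>3 / 2\<close>, the length is at least \<open>1 + t / 3\<close> (lemma
  \<open>horizontal_curve_length_ge\<close>).  The estimate is obtained by integrating a pointwise bound on the
  speed in which \<open>\<bar>u\<^sub>2\<bar>\<close> and \<open>\<bar>u\<^sub>1\<bar>\<close> are mixed with the weights \<open>1 - \<phi>\<close> and \<open>\<phi>\<close>, where \<open>\<phi>\<close> is
  \<open>x\<^sub>1\<^sup>2\<close> divided by its maximum; the integrals are then increments of coordinates, by the
  fundamental theorem of calculus for absolutely continuous functions.

  Such points are reached from \<open>p\<close> by the commutator of \<open>exp (t X\<^sub>1)\<close> and \<open>exp (- t X\<^sub>2)\<close>, that is, by
  a curve of length \<open>4 t\<close>.  Every homomorphism to \<open>\<real>\<close> vanishes on this commutator, so a Pansu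
  differential at \<open>p\<close> would force the distance to the identity to change by \<open>o(t)\<close>, whereas it grows
  from 1 to at least \<open>1 + t / 3\<close> (lemma \<open>cc_dist_commutator_point\<close>): the difference quotient is
  at least 1/12.
\<close>

section \<open>Absolutely continuous functions\<close>

lemma absolutely_continuous_on_dominated:
  assumes f: "absolutely_continuous_on a b f"
    and le: "\<And>s t. s \<in> {c..d} \<Longrightarrow> t \<in> {c..d} \<Longrightarrow> \<bar>g t - g s\<bar> \<le> K * \<bar>f t - f s\<bar>"
    and sub: "a \<le> c" "d \<le> b"
  shows "absolutely_continuous_on c d g"
  unfolding absolutely_continuous_on_def
proof (intro allI impI)
  fix \<epsilon> :: real assume "0 < \<epsilon>"
  define L where "L = \<bar>K\<bar> + 1"
  have "L > 0" by (simp add: L_def)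
  then have "0 < \<epsilon> / L" using \<open>0 < \<epsilon>\<close> by simp
  then obtain \<delta> where "0 < \<delta>" and \<delta>:
    "\<And>D. finite D \<and> (\<forall>(s, t)\<in>D. a \<le> s \<and> s < t \<and> t \<le> b) \<and>
       pairwise (\<lambda>p q. disjnt {fst p<..<snd p} {fst q<..<snd q}) D \<and>
       (\<Sum>(s, t)\<in>D. t - s) < \<delta> \<Longrightarrow> (\<Sum>(s, t)\<in>D. \<bar>f t - f s\<bar>) < \<epsilon> / L"
    using f unfolding absolutely_continuous_on_def by meson
  have "(\<Sum>(s, t)\<in>D. \<bar>g t - g s\<bar>) < \<epsilon>"
    if "finite D" and D: "\<forall>(s, t)\<in>D. c \<le> s \<and> s < t \<and> t \<le> d"
      and "pairwise (\<lambda>p q. disjnt {fst p<..<snd p} {fst q<..<snd q}) D"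
      and "(\<Sum>(s, t)\<in>D. t - s) < \<delta>" for D
  proof -
    have "(\<Sum>(s, t)\<in>D. \<bar>g t - g s\<bar>) \<le> (\<Sum>(s, t)\<in>D. L * \<bar>f t - f s\<bar>)"
    proof (intro sum_mono, clarify)
      fix s t assume "(s, t) \<in> D"
      then have "\<bar>g t - g s\<bar> \<le> K * \<bar>f t - f s\<bar>" using D le by fastforce
      also have "\<dots> \<le> L * \<bar>f t - f s\<bar>"
        by (intro mult_right_mono) (auto simp: L_def)
      finally show "\<bar>g t - g s\<bar> \<le> L * \<bar>f t - f s\<bar>" .
    qed
    also have "\<dots> = L * (\<Sum>(s, t)\<in>D. \<bar>f t - f s\<bar>)"
      by (simp add: sum_distrib_left case_prod_unfold)
    also have "\<dots> < L * (\<epsilon> / L)"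
      using \<open>L > 0\<close> sub D that by (intro mult_strict_left_mono \<delta> conjI) fastforce+
    finally show ?thesis using \<open>L > 0\<close> by simp
  qed
  then show "\<exists>\<delta>>0. \<forall>D. finite D \<and> (\<forall>(s, t)\<in>D. c \<le> s \<and> s < t \<and> t \<le> d) \<and>
      pairwise (\<lambda>p q. disjnt {fst p<..<snd p} {fst q<..<snd q}) D \<and> (\<Sum>(s, t)\<in>D. t - s) < \<delta> \<longrightarrow>
      (\<Sum>(s, t)\<in>D. \<bar>g t - g s\<bar>) < \<epsilon>"
    using \<open>0 < \<delta>\<close> by blast
qed

lemma absolutely_continuous_on_id: "absolutely_continuous_on a b (\<lambda>t. t)"
  unfolding absolutely_continuous_on_def
proof (intro allI impI)
  fix \<epsilon> :: real assume "0 < \<epsilon>"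
  moreover have "(\<Sum>(s, t)\<in>D. \<bar>t - s\<bar>) = (\<Sum>(s, t)\<in>D. t - s)"
    if "\<forall>(s, t)\<in>D. a \<le> s \<and> s < t \<and> t \<le> b" for D :: "(real \<times> real) set"
    using that by (intro sum.cong) auto
  ultimately show "\<exists>\<delta>>0. \<forall>D. finite D \<and> (\<forall>(s, t)\<in>D. a \<le> s \<and> s < t \<and> t \<le> b) \<and>
      pairwise (\<lambda>p q. disjnt {fst p<..<snd p} {fst q<..<snd q}) D \<and> (\<Sum>(s, t)\<in>D. t - s) < \<delta> \<longrightarrow>
      (\<Sum>(s, t)\<in>D. \<bar>t - s\<bar>) < \<epsilon>"
    by (intro exI [of _ \<epsilon>]) auto
qed

lemma lipschitz_imp_absolutely_continuous_on:
  assumes "K-lipschitz_on {a..b} f"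
  shows "absolutely_continuous_on a b f"
  using absolutely_continuous_on_id
proof (rule absolutely_continuous_on_dominated [where a = a and b = b])
  show "\<bar>f t - f s\<bar> \<le> K * \<bar>t - s\<bar>" if "s \<in> {a..b}" "t \<in> {a..b}" for s t
    using lipschitz_onD [OF assms that(2,1)] by (simp add: dist_real_def)
qed simp_all

lemma absolutely_continuous_on_imp_continuous_on:
  assumes f: "absolutely_continuous_on a b f"
  shows "continuous_on {a..b} f"
  unfolding continuous_on_iff
proof (intro ballI allI impI)
  fix x \<epsilon> :: real assume x: "x \<in> {a..b}" and "0 < \<epsilon>"
  obtain \<delta> where "0 < \<delta>" and \<delta>:
    "\<And>D. finite D \<and> (\<forall>(s, t)\<in>D. a \<le> s \<and> s < t \<and> t \<le> b) \<and>
       pairwise (\<lambda>p q. disjnt {fst p<..<snd p} {fst q<..<snd q}) D \<and>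
       (\<Sum>(s, t)\<in>D. t - s) < \<delta> \<Longrightarrow> (\<Sum>(s, t)\<in>D. \<bar>f t - f s\<bar>) < \<epsilon>"
    using f \<open>0 < \<epsilon>\<close> unfolding absolutely_continuous_on_def by meson
  have *: "\<bar>f t - f s\<bar> < \<epsilon>" if "s < t" "a \<le> s" "t \<le> b" "t - s < \<delta>" for s t
    using \<delta> [of "{(s, t)}"] that by (auto simp: pairwise_def)
  have "dist (f y) (f x) < \<epsilon>" if "y \<in> {a..b}" "dist y x < \<delta>" for y
    using *[of x y] *[of y x] that x \<open>0 < \<epsilon>\<close>
    by (cases x y rule: linorder_cases) (auto simp: dist_real_def abs_minus_commute)
  then show "\<exists>d>0. \<forall>y\<in>{a..b}. dist y x < d \<longrightarrow> dist (f y) (f x) < \<epsilon>"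
    using \<open>0 < \<delta>\<close> by blast
qed

text \<open>
  The form needed for tagged divisions, where the tag of a cell may lie in its interior.
\<close>

lemma straddle_derivative:
  assumes d: "(f has_real_derivative f') (at x within {a..b})" and "0 < \<epsilon>"
  obtains \<delta> where "0 < \<delta>"
    "\<And>u v. a \<le> u \<Longrightarrow> u \<le> x \<Longrightarrow> x \<le> v \<Longrightarrow> v \<le> b \<Longrightarrow> {u..v} \<subseteq> ball x \<delta> \<Longrightarrow>
       \<bar>(v - u) * f' - (f v - f u)\<bar> \<le> \<epsilon> * (v - u)"
proof -
  have "(f has_derivative (\<lambda>h. f' * h)) (at x within {a..b})"
    using d by (simp add: has_field_derivative_def)
  then obtain \<delta> where "0 < \<delta>" and \<delta>:
    "\<And>y. y \<in> {a..b} \<Longrightarrow> norm (y - x) < \<delta> \<Longrightarrow> norm (f y - f x - f' * (y - x)) \<le> \<epsilon> * norm (y - x)"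
    using \<open>0 < \<epsilon>\<close> unfolding has_derivative_within_alt by blast
  show thesis
  proof (rule that [OF \<open>0 < \<delta>\<close>])
    fix u v assume uv: "a \<le> u" "u \<le> x" "x \<le> v" "v \<le> b" and "{u..v} \<subseteq> ball x \<delta>"
    then have "u \<in> ball x \<delta>" "v \<in> ball x \<delta>"
      by (meson atLeastAtMost_iff order_refl order_trans subsetD)+
    then have "\<bar>f u - f x - f' * (u - x)\<bar> \<le> \<epsilon> * \<bar>u - x\<bar>" "\<bar>f v - f x - f' * (v - x)\<bar> \<le> \<epsilon> * \<bar>v - x\<bar>"
      using \<delta> [of u] \<delta> [of v] uv by (auto simp: dist_real_def)
    moreover have "\<epsilon> * \<bar>u - x\<bar> + \<epsilon> * \<bar>v - x\<bar> = \<epsilon> * (v - u)"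
      using uv by (simp add: algebra_simps abs_if)
    moreover have "(v - u) * f' - (f v - f u) = (f u - f x - f' * (u - x)) - (f v - f x - f' * (v - x))"
      by (simp add: algebra_simps)
    ultimately show "\<bar>(v - u) * f' - (f v - f u)\<bar> \<le> \<epsilon> * (v - u)" by linarith
  qed
qed

text \<open>
  Refine a tagged division so that its cells tagged outside \<open>S\<close> obey the straddle estimate; they
  contribute an error of at most a multiple of \<open>b - a\<close>.  The cells tagged in \<open>S\<close> do not contribute
  to the Riemann sum once \<open>f'\<close> is set to 0 on \<open>S\<close>, and since the indicator of \<open>S\<close> has integral 0,
  a fine enough gauge makes their total length so small that absolute continuity bounds the
  increments of \<open>f\<close> over them.
\<close>

theorem fundamental_theorem_of_calculus_absolutely_continuous:
  fixes f f' :: "real \<Rightarrow> real"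
  assumes "a \<le> b" and ac: "absolutely_continuous_on a b f" and "negligible S"
    and deriv: "\<And>x. x \<in> {a..b} - S \<Longrightarrow> (f has_real_derivative f' x) (at x within {a..b})"
  shows "(f' has_integral (f b - f a)) {a..b}"
proof -
  define g where "g x = (if x \<in> S then 0 else f' x)" for x
  have "(g has_integral (f b - f a)) {a..b}"
    unfolding has_integral_real
  proof (intro allI impI)
    fix \<epsilon> :: real assume "0 < \<epsilon>"
    define \<eta> where "\<eta> = \<epsilon> / (2 * (b - a + 1))"
    have "0 < \<eta>" using \<open>0 < \<epsilon>\<close> \<open>a \<le> b\<close> by (simp add: \<eta>_def)
    have \<eta>: "\<eta> * (b - a) \<le> \<epsilon> / 2"
    proof -
      have "\<eta> * (b - a) \<le> \<eta> * (b - a + 1)" using \<open>0 < \<eta>\<close> by simp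
      also have "\<dots> = \<epsilon> / 2" using \<open>a \<le> b\<close> by (simp add: \<eta>_def divide_simps)
      finally show ?thesis .
    qed
    have "0 < \<epsilon> / 2" using \<open>0 < \<epsilon>\<close> by simp
    then obtain \<delta> where "0 < \<delta>" and \<delta>:
      "\<And>D. finite D \<and> (\<forall>(s, t)\<in>D. a \<le> s \<and> s < t \<and> t \<le> b) \<and>
         pairwise (\<lambda>p q. disjnt {fst p<..<snd p} {fst q<..<snd q}) D \<and>
         (\<Sum>(s, t)\<in>D. t - s) < \<delta> \<Longrightarrow> (\<Sum>(s, t)\<in>D. \<bar>f t - f s\<bar>) < \<epsilon> / 2"
      using ac unfolding absolutely_continuous_on_def by meson
    have "((indicator S :: real \<Rightarrow> real) has_integral 0) {a..b}"
      using \<open>negligible S\<close> unfolding negligible_def by (metis box_real(2))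
    then obtain \<gamma> where "gauge \<gamma>" and \<gamma>:
      "\<And>D. D tagged_division_of {a..b} \<Longrightarrow> \<gamma> fine D \<Longrightarrow>
         norm ((\<Sum>(x, k)\<in>D. measure lborel k *\<^sub>R (indicator S x :: real)) - 0) < \<delta>"
      unfolding has_integral_real using \<open>0 < \<delta>\<close> by meson
    have "\<exists>d>0. x \<in> {a..b} - S \<longrightarrow> (\<forall>u v. a \<le> u \<longrightarrow> u \<le> x \<longrightarrow> x \<le> v \<longrightarrow> v \<le> b \<longrightarrow> {u..v} \<subseteq> ball x d \<longrightarrow>
        \<bar>(v - u) * f' x - (f v - f u)\<bar> \<le> \<eta> * (v - u))" for x
    proof (cases "x \<in> {a..b} - S")
      case True
      then show ?thesis by (rule_tac straddle_derivative [OF deriv [OF True] \<open>0 < \<eta>\<close>]) blast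
    qed (auto intro: zero_less_one)
    then obtain d where d: "\<And>x. 0 < d x" "\<And>x u v. x \<in> {a..b} - S \<Longrightarrow> a \<le> u \<Longrightarrow> u \<le> x \<Longrightarrow> x \<le> v \<Longrightarrow>
        v \<le> b \<Longrightarrow> {u..v} \<subseteq> ball x (d x) \<Longrightarrow> \<bar>(v - u) * f' x - (f v - f u)\<bar> \<le> \<eta> * (v - u)"
      by metis
    define \<rho> where "\<rho> x = \<gamma> x \<inter> ball x (d x)" for x
    have "gauge \<rho>"
      unfolding \<rho>_def using \<open>gauge \<gamma>\<close> gauge_ball_dependent [of d] d(1) by (intro gauge_Int) auto
    moreover have "norm ((\<Sum>(x, k)\<in>D. measure lborel k *\<^sub>R g x) - (f b - f a)) < \<epsilon>"
      if D: "D tagged_division_of {a..b}" and fine: "\<rho> fine D" for D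
    proof -
      have "\<gamma> fine D" and fine_d: "(\<lambda>x. ball x (d x)) fine D"
        using fine unfolding \<rho>_def fine_Int by auto
      have "finite D" using D by blast
      have interval: "k = {Inf k..Sup k}" "a \<le> Inf k" "Inf k \<le> x" "x \<le> Sup k" "Sup k \<le> b"
        if xk: "(x, k) \<in> D" for x k
      proof -
        obtain u v where k: "k = cbox u v" using tagged_division_ofD(4) [OF D xk] by blast
        have "x \<in> k" "k \<subseteq> {a..b}" using tagged_division_ofD(2,3) [OF D xk] .
        moreover from this k have "u \<le> v" by auto
        ultimately show "k = {Inf k..Sup k}" "a \<le> Inf k" "Inf k \<le> x" "x \<le> Sup k" "Sup k \<le> b"
          using k by auto
      qed
      have content: "measure lborel k = Sup k - Inf k" if "(x, k) \<in> D" for x k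
        using interval [OF that] content_real [of "Inf k" "Sup k"] by (metis order_trans)
      have Inf_le_Sup: "Inf k \<le> Sup k" if "(x, k) \<in> D" for x k
        using interval(3,4) [OF that] by linarith
      define A where "A = {p \<in> D. fst p \<in> S}"
      have A: "A \<subseteq> D" "finite A" using \<open>finite D\<close> by (auto simp: A_def)
      let ?h = "\<lambda>(x, k). measure lborel k *\<^sub>R g x - (f (Sup k) - f (Inf k))"
      have "(\<Sum>(x, k)\<in>D. measure lborel k *\<^sub>R g x) - (f b - f a) = sum ?h D"
        unfolding additive_tagged_division_1 [OF \<open>a \<le> b\<close> D, of f, symmetric] sum_subtractf [symmetric]
        by (intro sum.cong) auto
      also have "\<dots> = sum ?h (D - A) + sum ?h A"
        by (rule sum.subset_diff [OF A(1) \<open>finite D\<close>])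
      finally have split: "\<bar>(\<Sum>(x, k)\<in>D. measure lborel k *\<^sub>R g x) - (f b - f a)\<bar> \<le> \<bar>sum ?h (D - A)\<bar> + \<bar>sum ?h A\<bar>"
        by linarith
      have "\<bar>sum ?h (D - A)\<bar> \<le> (\<Sum>(x, k)\<in>D - A. \<eta> * (Sup k - Inf k))"
      proof (rule order_trans [OF sum_abs], intro sum_mono, clarify)
        fix x k assume xk: "(x, k) \<in> D" "(x, k) \<notin> A"
        have "x \<in> {a..b} - S" using xk interval [OF xk(1)] by (auto simp: A_def)
        moreover have "{Inf k..Sup k} \<subseteq> ball x (d x)"
          using fine_d xk(1) interval(1) [OF xk(1)] by (metis fineD)
        ultimately have "\<bar>(Sup k - Inf k) * f' x - (f (Sup k) - f (Inf k))\<bar> \<le> \<eta> * (Sup k - Inf k)"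
          using interval [OF xk(1)] by (intro d(2))
        then show "\<bar>measure lborel k *\<^sub>R g x - (f (Sup k) - f (Inf k))\<bar> \<le> \<eta> * (Sup k - Inf k)"
          using \<open>x \<in> {a..b} - S\<close> content [OF xk(1)] by (simp add: g_def)
      qed
      also have "\<dots> \<le> (\<Sum>(x, k)\<in>D. \<eta> * (Sup k - Inf k))"
        using \<open>finite D\<close> \<open>0 < \<eta>\<close> Inf_le_Sup
        by (intro sum_mono2) auto
      also have "\<dots> = \<eta> * (b - a)"
        using additive_tagged_division_1 [OF \<open>a \<le> b\<close> D, of "\<lambda>x. x"]
        by (simp add: sum_distrib_left [symmetric] case_prod_unfold)
      finally have good: "\<bar>sum ?h (D - A)\<bar> \<le> \<epsilon> / 2" using \<eta> by linarith
      have bad: "\<bar>sum ?h A\<bar> < \<epsilon> / 2"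
      proof -
        \<comment> \<open>Degenerate cells are dropped: only for the others do disjoint interiors make the map
          to pairs of end points injective, and absolute continuity speaks of proper intervals.\<close>
        define B where "B = {p \<in> A. Inf (snd p) < Sup (snd p)}"
        define \<iota> where "\<iota> p = (Inf (snd p), Sup (snd p))" for p :: "real \<times> real set"
        have B: "B \<subseteq> A" "finite B" using A by (auto simp: B_def)
        have disj: "disjnt {Inf k<..<Sup k} {Inf l<..<Sup l}"
          if "(x, k) \<in> D" "(y, l) \<in> D" "(x, k) \<noteq> (y, l)" for x k y l
        proof -
          have "interior k \<inter> interior l = {}" using tagged_division_ofD(5) [OF D that] .
          then show ?thesis
            using interval(1) [OF that(1)] interval(1) [OF that(2)]
            by (metis disjnt_def interior_atLeastAtMost_real)
        qed
        have inj: "inj_on \<iota> B"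
        proof (rule inj_onI, rule ccontr)
          fix p q assume pq: "p \<in> B" "q \<in> B" "\<iota> p = \<iota> q" "p \<noteq> q"
          then have "disjnt {Inf (snd p)<..<Sup (snd p)} {Inf (snd q)<..<Sup (snd q)}"
            using disj [of "fst p" "snd p" "fst q" "snd q"] A(1) B(1) by auto
          then show False using pq dense [of "Inf (snd p)" "Sup (snd p)"]
            by (auto simp: \<iota>_def disjnt_def B_def)
        qed
        have "(\<Sum>(s, t)\<in>\<iota> ` B. t - s) = (\<Sum>(x, k)\<in>B. Sup k - Inf k)"
          by (subst sum.reindex [OF inj]) (simp add: \<iota>_def case_prod_unfold)
        also have "\<dots> = (\<Sum>(x, k)\<in>B. measure lborel k *\<^sub>R indicator S x)"
          using A(1) by (intro sum.cong) (auto simp: B_def A_def content)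
        also have "\<dots> \<le> (\<Sum>(x, k)\<in>D. measure lborel k *\<^sub>R indicator S x)"
          using A(1) B(1) \<open>finite D\<close> by (intro sum_mono2) auto
        also have "\<dots> < \<delta>"
          using \<gamma> [OF D \<open>\<gamma> fine D\<close>] by simp
        finally have "(\<Sum>(s, t)\<in>\<iota> ` B. t - s) < \<delta>" .
        then have "(\<Sum>(s, t)\<in>\<iota> ` B. \<bar>f t - f s\<bar>) < \<epsilon> / 2"
        proof (intro \<delta> conjI)
          show "\<forall>(s, t)\<in>\<iota> ` B. a \<le> s \<and> s < t \<and> t \<le> b"
            using A(1) interval(2,5) by (auto simp: \<iota>_def B_def)
          show "pairwise (\<lambda>p q. disjnt {fst p<..<snd p} {fst q<..<snd q}) (\<iota> ` B)"
            unfolding pairwise_image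
          proof (intro pairwiseI impI)
            fix p q assume "p \<in> B" "q \<in> B" "p \<noteq> q"
            then show "disjnt {fst (\<iota> p)<..<snd (\<iota> p)} {fst (\<iota> q)<..<snd (\<iota> q)}"
              using disj [of "fst p" "snd p" "fst q" "snd q"] A(1) B(1) by (auto simp: \<iota>_def)
          qed
        qed (use B in auto)
        also have "(\<Sum>(s, t)\<in>\<iota> ` B. \<bar>f t - f s\<bar>) = (\<Sum>(x, k)\<in>B. \<bar>f (Sup k) - f (Inf k)\<bar>)"
          by (subst sum.reindex [OF inj]) (simp add: \<iota>_def case_prod_unfold)
        also have "\<dots> = (\<Sum>(x, k)\<in>A. \<bar>f (Sup k) - f (Inf k)\<bar>)"
        proof (intro sum.mono_neutral_left ballI)
          fix p assume "p \<in> A - B"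
          moreover obtain x k where "p = (x, k)" by force
          ultimately have "(x, k) \<in> D" "\<not> Inf k < Sup k" using A(1) by (auto simp: B_def)
          then have "Sup k = Inf k" using Inf_le_Sup [of x k] by linarith
          then show "(case p of (x, k) \<Rightarrow> \<bar>f (Sup k) - f (Inf k)\<bar>) = 0" by (simp add: \<open>p = (x, k)\<close>)
        qed (use A B in auto)
        finally have "(\<Sum>(x, k)\<in>A. \<bar>f (Sup k) - f (Inf k)\<bar>) < \<epsilon> / 2" .
        moreover have "\<bar>sum ?h A\<bar> \<le> (\<Sum>(x, k)\<in>A. \<bar>f (Sup k) - f (Inf k)\<bar>)"
          by (rule order_trans [OF sum_abs], intro sum_mono) (auto simp: A_def g_def)
        ultimately show ?thesis by linarith
      qed
      show ?thesis using split good bad by simp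
    qed
    ultimately show "\<exists>\<gamma>. gauge \<gamma> \<and> (\<forall>D. D tagged_division_of {a..b} \<and> \<gamma> fine D \<longrightarrow>
        norm ((\<Sum>(x, k)\<in>D. measure lborel k *\<^sub>R g x) - (f b - f a)) < \<epsilon>)"
      by (intro exI [of _ \<rho>]) simp
  qed
  then show ?thesis
    by (rule has_integral_spike [OF \<open>negligible S\<close>, rotated]) (simp add: g_def)
qed


section \<open>A lower bound for the length of horizontal curves\<close>

text \<open>
The integrand is the modulus of the complex-valued function with parts \<open>f\<close> and \<open>g\<close>.
\<close>

lemma absolutely_integrable_sqrt_sum_squares:
  fixes f g :: "real \<Rightarrow> real"
  assumes "f absolutely_integrable_on S" "g absolutely_integrable_on S"
  shows "(\<lambda>x. sqrt ((f x)\<^sup>2 + (g x)\<^sup>2)) integrable_on S"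
proof -
  have "(\<lambda>x. complex_of_real (f x)) absolutely_integrable_on S"
    using absolutely_integrable_linear [OF assms(1) bounded_linear_of_real [where 'a = complex]]
    by (simp add: o_def)
  moreover have "(\<lambda>x. \<i> * complex_of_real (g x)) absolutely_integrable_on S"
    using absolutely_integrable_linear [OF assms(2) bounded_linear_compose
        [OF bounded_linear_mult_right [of "\<i>"] bounded_linear_of_real [where 'a = complex]]]
    by (simp add: o_def)
  ultimately have "(\<lambda>x. complex_of_real (f x) + \<i> * complex_of_real (g x)) absolutely_integrable_on S"
    by (rule set_integral_add(1))
  then have "(\<lambda>x. cmod (complex_of_real (f x) + \<i> * complex_of_real (g x))) integrable_on S"
    unfolding absolutely_integrable_on_def by blast
  then show ?thesis by (simp add: cmod_def)
qed

lemma control_length_integrable: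
  assumes "horizontal_curve n a b \<gamma> u1 u2"
  shows "(\<lambda>t. sqrt ((u1 t)\<^sup>2 + (u2 t)\<^sup>2)) integrable_on {a..b}"
  using assms unfolding horizontal_curve_def
  by (intro absolutely_integrable_sqrt_sum_squares) auto

lemma horizontal_curve_derivatives:
  assumes "4 \<le> n" and hc: "horizontal_curve n a b \<gamma> u1 u2"
  obtains N where "negligible N"
    "\<And>t. t \<in> {a..b} - N \<Longrightarrow> ((\<lambda>s. \<gamma> s 1) has_real_derivative u1 t) (at t within {a..b})"
    "\<And>t. t \<in> {a..b} - N \<Longrightarrow> ((\<lambda>s. \<gamma> s 2) has_real_derivative u2 t) (at t within {a..b})"
    "\<And>t. t \<in> {a..b} - N \<Longrightarrow>
       ((\<lambda>s. \<gamma> s 4) has_real_derivative u2 t * (\<gamma> t 1)\<^sup>2 / 2) (at t within {a..b})"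
proof -
  have "AE t in lebesgue_on {a..b}. \<forall>j. ((\<lambda>s. \<gamma> s j) has_real_derivative
      u1 t * filiform_X n 1 (\<gamma> t) j + u2 t * filiform_X n 2 (\<gamma> t) j) (at t within {a..b})"
    using hc unfolding horizontal_curve_def by blast
  then obtain N where N: "N \<in> null_sets (lebesgue_on {a..b})"
    "{t \<in> space (lebesgue_on {a..b}). \<not> (\<forall>j. ((\<lambda>s. \<gamma> s j) has_real_derivative
       u1 t * filiform_X n 1 (\<gamma> t) j + u2 t * filiform_X n 2 (\<gamma> t) j) (at t within {a..b}))} \<subseteq> N"
    unfolding eventually_ae_filter by blast
  then have d: "((\<lambda>s. \<gamma> s j) has_real_derivative
      u1 t * filiform_X n 1 (\<gamma> t) j + u2 t * filiform_X n 2 (\<gamma> t) j) (at t within {a..b})"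
    if "t \<in> {a..b} - N" for t j
    using that by auto
  show thesis
  proof
    show "negligible N"
      using N(1) by (simp add: null_sets_restrict_space negligible_iff_null_sets)
    fix t assume t: "t \<in> {a..b} - N"
    have X: "filiform_X n (Suc 0) = (\<lambda>_. unit_coord 1)"
      using filiform_X_one by (simp add: fun_eq_iff)
    show "((\<lambda>s. \<gamma> s 1) has_real_derivative u1 t) (at t within {a..b})"
      using d [OF t, of 1] by (simp add: X filiform_X_formula unit_coord_def)
    show "((\<lambda>s. \<gamma> s 2) has_real_derivative u2 t) (at t within {a..b})"
      using d [OF t, of 2] \<open>4 \<le> n\<close> by (simp add: X filiform_X_formula unit_coord_def)
    show "((\<lambda>s. \<gamma> s 4) has_real_derivative u2 t * (\<gamma> t 1)\<^sup>2 / 2) (at t within {a..b})"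
      using d [OF t, of 4] \<open>4 \<le> n\<close> by (simp add: X filiform_X_formula unit_coord_def)
  qed
qed

text \<open>
  Write \<open>x\<close> for the first coordinate, let \<open>M = \<bar>x \<tau>\<bar>\<close> be the maximum of \<open>\<bar>x\<bar>\<close>, and put
  \<open>\<phi> = x\<^sup>2 / M\<^sup>2\<close>, so that \<open>0 \<le> \<phi> \<le> 1\<close>.  The speed \<open>\<surd>(u\<^sub>1\<^sup>2 + u\<^sub>2\<^sup>2)\<close> bounds both
  \<open>\<sigma> u\<^sub>2\<close> and \<open>\<bar>u\<^sub>1\<bar>\<close>, hence also the convex combination \<open>\<sigma> u\<^sub>2 (1 - \<phi>) + \<bar>u\<^sub>1\<bar> \<phi>\<close>.  The
  integral of the first summand is known exactly, because \<open>u\<^sub>2\<close> and \<open>u\<^sub>2 x\<^sup>2 / 2\<close> are the derivatives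
  of the second and the fourth coordinate: it is \<open>\<sigma> (\<gamma> b 2 - \<gamma> a 2) + t\<^sup>3 / M\<^sup>2\<close>.  The second is at
  least \<open>M / 3\<close>, because \<open>x\<^sup>3\<close> has to grow from 0 to \<open>\<plusminus>M\<^sup>3\<close> before time \<open>\<tau>\<close>.  A small \<open>M\<close> is
  thus penalised by \<open>t\<^sup>3 / M\<^sup>2\<close> and a large one by \<open>M / 3\<close>.
\<close>

lemma horizontal_curve_length_ge:
  assumes "4 \<le> n" "a < b" and hc: "horizontal_curve n a b \<gamma> u1 u2"
    and start: "\<gamma> a 1 = 0" and \<sigma>: "\<bar>\<sigma>\<bar> = 1" and "0 < t"
    and X4: "\<sigma> * (\<gamma> b 4 - \<gamma> a 4) = - (t ^ 3) / 2"
  shows "\<sigma> * (\<gamma> b 2 - \<gamma> a 2) + t / 3 \<le> control_length a b u1 u2"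
proof -
  obtain N where "negligible N"
    and d1: "\<And>t. t \<in> {a..b} - N \<Longrightarrow> ((\<lambda>s. \<gamma> s 1) has_real_derivative u1 t) (at t within {a..b})"
    and d2: "\<And>t. t \<in> {a..b} - N \<Longrightarrow> ((\<lambda>s. \<gamma> s 2) has_real_derivative u2 t) (at t within {a..b})"
    and d4: "\<And>t. t \<in> {a..b} - N \<Longrightarrow>
       ((\<lambda>s. \<gamma> s 4) has_real_derivative u2 t * (\<gamma> t 1)\<^sup>2 / 2) (at t within {a..b})"
    by (rule horizontal_curve_derivatives [OF \<open>4 \<le> n\<close> hc]) (rule that)
  have ac: "absolutely_continuous_on a b (\<lambda>s. \<gamma> s j)" for j
    using hc unfolding horizontal_curve_def by blast
  define x where "x s = \<gamma> s 1" for s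
  have "continuous_on {a..b} (\<lambda>s. \<bar>x s\<bar>)"
    unfolding x_def by (intro continuous_intros absolutely_continuous_on_imp_continuous_on ac)
  then obtain \<tau> where \<tau>: "\<tau> \<in> {a..b}" and max: "\<And>s. s \<in> {a..b} \<Longrightarrow> \<bar>x s\<bar> \<le> \<bar>x \<tau>\<bar>"
    using continuous_attains_sup [of "{a..b}" "\<lambda>s. \<bar>x s\<bar>"] \<open>a < b\<close> by auto
  define M where "M = \<bar>x \<tau>\<bar>"
  have I2: "(u2 has_integral (\<gamma> b 2 - \<gamma> a 2)) {a..b}"
    using \<open>a < b\<close> by (intro fundamental_theorem_of_calculus_absolutely_continuous
        [OF _ ac \<open>negligible N\<close> d2]) auto
  have I4: "((\<lambda>s. u2 s * (x s)\<^sup>2 / 2) has_integral (\<gamma> b 4 - \<gamma> a 4)) {a..b}"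
    unfolding x_def using \<open>a < b\<close> by (intro fundamental_theorem_of_calculus_absolutely_continuous
        [OF _ ac \<open>negligible N\<close> d4]) auto
  have I3: "((\<lambda>s. 3 * (x s)\<^sup>2 * u1 s) has_integral (x \<tau> ^ 3 - x a ^ 3)) {a..\<tau>}"
  proof (rule fundamental_theorem_of_calculus_absolutely_continuous [OF _ _ \<open>negligible N\<close>])
    show "absolutely_continuous_on a \<tau> (\<lambda>s. x s ^ 3)"
    proof (rule absolutely_continuous_on_dominated [OF ac [of 1]])
      fix s r assume sr: "s \<in> {a..\<tau>}" "r \<in> {a..\<tau>}"
      have le: "\<bar>x s\<bar> \<le> M" "\<bar>x r\<bar> \<le> M" using max sr \<tau> by (auto simp: M_def)
      have "\<bar>x r ^ 3 - x s ^ 3\<bar> = \<bar>x r * x r + x r * x s + x s * x s\<bar> * \<bar>x r - x s\<bar>"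
        by (simp add: abs_mult [symmetric] power3_eq_cube algebra_simps)
      also have "\<dots> \<le> 3 * M\<^sup>2 * \<bar>x r - x s\<bar>"
      proof (intro mult_right_mono)
        have "\<bar>x r * x r\<bar> \<le> M * M" "\<bar>x r * x s\<bar> \<le> M * M" "\<bar>x s * x s\<bar> \<le> M * M"
          unfolding abs_mult using le by (intro mult_mono; simp)+
        then show "\<bar>x r * x r + x r * x s + x s * x s\<bar> \<le> 3 * M\<^sup>2"
          unfolding power2_eq_square by linarith
      qed simp
      finally show "\<bar>x r ^ 3 - x s ^ 3\<bar> \<le> 3 * M\<^sup>2 * \<bar>\<gamma> r 1 - \<gamma> s 1\<bar>" by (simp add: x_def)
    qed (use \<tau> in auto)
    fix s assume s: "s \<in> {a..\<tau>} - N"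
    then have "(x has_real_derivative u1 s) (at s within {a..\<tau>})"
      unfolding x_def using \<tau> by (intro DERIV_subset [OF d1]) auto
    then show "((\<lambda>s. x s ^ 3) has_real_derivative 3 * (x s)\<^sup>2 * u1 s) (at s within {a..\<tau>})"
      using DERIV_power [of x "u1 s" s "{a..\<tau>}" 3] by (simp add: mult_ac)
  qed (use \<tau> in auto)
  have "x a = 0" using start by (simp add: x_def)
  have "M \<noteq> 0"
  proof
    assume "M = 0"
    then have "u2 s * (x s)\<^sup>2 / 2 = 0" if "s \<in> {a..b}" for s
      using max [OF that] by (simp add: M_def)
    then have "((\<lambda>s. u2 s * (x s)\<^sup>2 / 2) has_integral 0) {a..b}"
      by (rule has_integral_is_0)
    then have "\<gamma> b 4 - \<gamma> a 4 = 0"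
      by (rule has_integral_unique [OF I4])
    then show False using X4 \<open>0 < t\<close> by simp
  qed
  then have "0 < M" by (simp add: M_def)
  define \<kappa> where "\<kappa> = sgn (x \<tau>)"
  have \<kappa>: "\<bar>\<kappa>\<bar> \<le> 1" "\<kappa> * x \<tau> ^ 3 = M ^ 3"
    by (auto simp: \<kappa>_def M_def sgn_real_def abs_if)
  \<comment> \<open>This is \<open>\<sigma> u\<^sub>2 (1 - \<phi>)\<close>, plus \<open>\<kappa> u\<^sub>1 \<phi>\<close> up to time \<open>\<tau>\<close>, written as a combination of the
    three derivatives above.  After \<open>\<tau>\<close> the share \<open>\<phi>\<close> of the speed is discarded.\<close>
  define h where "h s = \<sigma> * u2 s - (2 * \<sigma> / M\<^sup>2) * (u2 s * (x s)\<^sup>2 / 2) +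
      (\<kappa> / (3 * M\<^sup>2)) * (if s \<in> {a..\<tau>} then 3 * (x s)\<^sup>2 * u1 s else 0)" for s
  have "((\<lambda>s. if s \<in> {a..\<tau>} then 3 * (x s)\<^sup>2 * u1 s else 0) has_integral x \<tau> ^ 3) {a..b}"
    using I3 \<tau> \<open>x a = 0\<close> by (subst has_integral_restrict) auto
  then have "(h has_integral \<sigma> * (\<gamma> b 2 - \<gamma> a 2) - (2 * \<sigma> / M\<^sup>2) * (\<gamma> b 4 - \<gamma> a 4) +
      (\<kappa> / (3 * M\<^sup>2)) * x \<tau> ^ 3) {a..b}"
    unfolding h_def by (intro has_integral_add has_integral_diff has_integral_mult_right I2 I4)
  moreover have "(2 * \<sigma> / M\<^sup>2) * (\<gamma> b 4 - \<gamma> a 4) = - (t ^ 3 / M\<^sup>2)"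
  proof -
    have "(2 * \<sigma> / M\<^sup>2) * (\<gamma> b 4 - \<gamma> a 4) = 2 * (\<sigma> * (\<gamma> b 4 - \<gamma> a 4)) / M\<^sup>2" by simp
    then show ?thesis unfolding X4 by simp
  qed
  moreover have "(\<kappa> / (3 * M\<^sup>2)) * x \<tau> ^ 3 = M / 3"
  proof -
    have "(\<kappa> / (3 * M\<^sup>2)) * x \<tau> ^ 3 = (\<kappa> * x \<tau> ^ 3) / (3 * M\<^sup>2)" by simp
    then show ?thesis unfolding \<kappa> using \<open>0 < M\<close> by (simp add: power2_eq_square power3_eq_cube)
  qed
  ultimately have Ih: "(h has_integral \<sigma> * (\<gamma> b 2 - \<gamma> a 2) + t ^ 3 / M\<^sup>2 + M / 3) {a..b}"
    by (simp only: diff_minus_eq_add)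
  have Il: "((\<lambda>s. sqrt ((u1 s)\<^sup>2 + (u2 s)\<^sup>2)) has_integral control_length a b u1 u2) {a..b}"
    unfolding control_length_def
    by (rule integrable_integral [OF control_length_integrable [OF hc]])
  have "\<sigma> * (\<gamma> b 2 - \<gamma> a 2) + t ^ 3 / M\<^sup>2 + M / 3 \<le> control_length a b u1 u2"
  proof (rule has_integral_le [OF Ih Il])
    fix s assume s: "s \<in> {a..b}"
    let ?r = "sqrt ((u1 s)\<^sup>2 + (u2 s)\<^sup>2)"
    define \<phi> where "\<phi> = (x s)\<^sup>2 / M\<^sup>2"
    have \<phi>: "0 \<le> \<phi>" "\<phi> \<le> 1"
      using max [OF s] \<open>0 < M\<close> by (auto simp: \<phi>_def M_def abs_le_square_iff divide_le_eq)
    have "h s = (\<sigma> * u2 s) * (1 - \<phi>) + (if s \<in> {a..\<tau>} then \<kappa> * u1 s else 0) * \<phi>"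
      by (simp add: h_def \<phi>_def algebra_simps)
    also have "\<dots> \<le> ?r * (1 - \<phi>) + ?r * \<phi>"
    proof (intro add_mono mult_right_mono)
      have "\<sigma> * u2 s \<le> \<bar>\<sigma>\<bar> * \<bar>u2 s\<bar>"
        unfolding abs_mult [symmetric] by (rule abs_ge_self)
      also have "\<dots> \<le> ?r" unfolding \<sigma> by (rule real_le_rsqrt) simp
      finally show "\<sigma> * u2 s \<le> ?r" .
      have "\<kappa> * u1 s \<le> \<bar>\<kappa>\<bar> * \<bar>u1 s\<bar>"
        unfolding abs_mult [symmetric] by (rule abs_ge_self)
      also have "\<dots> \<le> \<bar>u1 s\<bar>"
        using \<kappa>(1) by (intro mult_left_le_one_le) simp_all
      also have "\<dots> \<le> ?r" by (rule real_le_rsqrt) simp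
      finally show "(if s \<in> {a..\<tau>} then \<kappa> * u1 s else 0) \<le> ?r" by simp
    qed (use \<phi> in auto)
    finally show "h s \<le> ?r" by (simp add: algebra_simps)
  qed
  moreover have "t / 3 \<le> t ^ 3 / M\<^sup>2 + M / 3"
  proof (cases "t \<le> M")
    case True
    moreover have "0 \<le> t ^ 3 / M\<^sup>2" using \<open>0 < t\<close> by simp
    ultimately show ?thesis by linarith
  next
    case False
    then have "M\<^sup>2 \<le> t\<^sup>2" using \<open>0 < M\<close> by (intro power_mono) auto
    then have "t * M\<^sup>2 \<le> t * t\<^sup>2" using \<open>0 < t\<close> by (intro mult_left_mono) auto
    then have "t \<le> t ^ 3 / M\<^sup>2"
      using \<open>0 < M\<close> by (simp add: le_divide_eq power3_eq_cube power2_eq_square mult.assoc)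
    then show ?thesis using \<open>0 < t\<close> \<open>0 < M\<close> by linarith
  qed
  ultimately show ?thesis by linarith
qed

section \<open>Motion along the horizontal directions\<close>

text \<open>
This is \<open>exp (r X\<^sub>k)\<close>.
\<close>

definition filiform_axis :: "nat \<Rightarrow> real \<Rightarrow> nat \<Rightarrow> real" where
  "filiform_axis k r = (\<lambda>i. r * unit_coord k i)"

lemma filiform_axis_closed: "k \<in> {1..n} \<Longrightarrow> filiform_axis k r \<in> filiform_coords n"
  by (auto simp: filiform_axis_def filiform_coords_def unit_coord_def)

lemma filiform_mult_axis:
  assumes x: "x \<in> filiform_coords n" and k: "k \<in> {1..n}"
  shows "filiform_mult n x (filiform_axis k r) = (\<lambda>j. x j + r * filiform_X n k x j)"
proof
  fix j
  show "filiform_mult n x (filiform_axis k r) j = x j + r * filiform_X n k x j"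
  proof (cases "k = 1")
    case True
    then have "filiform_X n k x = unit_coord 1" by (simp add: filiform_X_one [simplified])
    then show ?thesis
      using True x k by (auto simp: filiform_mult_def filiform_axis_def unit_coord_def filiform_coords_def)
  next
    case False
    then have "2 \<le> k" using k by auto
    have "(\<Sum>l=2..j. (- x 1) ^ (j - l) / fact (j - l) * (r * unit_coord k l))
        = (\<Sum>l=2..j. if l = k then (- x 1) ^ (j - l) / fact (j - l) * r else 0)"
      by (intro sum.cong) (auto simp: unit_coord_def)
    then show ?thesis
      using \<open>2 \<le> k\<close> x k unfolding filiform_X_formula [OF \<open>2 \<le> k\<close>]
      by (auto simp: filiform_mult_def filiform_axis_def unit_coord_def filiform_coords_def)
  qed
qed

text \<open>
  Right multiplication by \<open>exp (r X\<^sub>k)\<close> is the flow of \<open>X\<^sub>k\<close>, and \<open>X\<^sub>k\<close> is constant along its flow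
  lines: for \<open>k \<ge> 2\<close> it depends only on the first coordinate, which that flow preserves.
\<close>

lemma filiform_X_mult_axis:
  assumes "x \<in> filiform_coords n" "k \<in> {1..n}"
  shows "filiform_X n k (filiform_mult n x (filiform_axis k r)) = filiform_X n k x"
proof (cases "k = 1")
  case True
  then show ?thesis by (simp add: filiform_X_one [simplified])
next
  case False
  then have "2 \<le> k" using assms by auto
  then have "filiform_mult n x (filiform_axis k r) 1 = x 1"
    using assms by (simp add: filiform_X_formula filiform_mult_axis)
  then show ?thesis
    unfolding filiform_X_formula [OF \<open>2 \<le> k\<close>] by (simp only:)
qed

lemma filiform_mult_axis_cancel:
  assumes "x \<in> filiform_coords n" "k \<in> {1..n}"
  shows "filiform_mult n (filiform_mult n x (filiform_axis k r)) (filiform_axis k (- r)) = x"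
proof -
  let ?y = "filiform_mult n x (filiform_axis k r)"
  have "?y \<in> filiform_coords n"
    using assms by (intro filiform_mult_closed) auto
  then have "filiform_mult n ?y (filiform_axis k (- r)) = (\<lambda>j. ?y j + (- r) * filiform_X n k x j)"
    using filiform_mult_axis [OF _ assms(2)] filiform_X_mult_axis [OF assms] by simp
  also have "\<dots> = x"
    by (simp add: filiform_mult_axis [OF assms])
  finally show ?thesis .
qed

text \<open>
  Lipschitz coordinates are demanded because, unlike absolute continuity in terms of
  \<open>\<epsilon>\<close> and \<open>\<delta>\<close>, they pass to concatenations without any splitting of intervals.
\<close>

definition lipschitz_joined ::
  "nat \<Rightarrow> real \<Rightarrow> real \<Rightarrow> (nat \<Rightarrow> real) \<Rightarrow> (nat \<Rightarrow> real) \<Rightarrow> real \<Rightarrow> bool" where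
  "lipschitz_joined n a b x y l \<longleftrightarrow> a < b \<and>
     (\<exists>\<gamma> u1 u2. horizontal_curve n a b \<gamma> u1 u2 \<and> (\<forall>j. \<exists>K. K-lipschitz_on {a..b} (\<lambda>t. \<gamma> t j)) \<and>
        \<gamma> a = x \<and> \<gamma> b = y \<and> control_length a b u1 u2 = l)"

lemma lipschitz_joined_axis:
  assumes "x \<in> filiform_coords n" "k \<in> {1, 2}" "2 \<le> n"
    and "b = a + 1" and y: "y = filiform_mult n x (filiform_axis k r)"
  shows "lipschitz_joined n a b x y \<bar>r\<bar>"
  unfolding \<open>b = a + 1\<close> y
proof -
  have k: "k \<in> {1..n}" using assms by auto
  define \<gamma> where "\<gamma> t = filiform_mult n x (filiform_axis k ((t - a) * r))" for t
  define u1 where "u1 = (\<lambda>t::real. if k = 1 then r else 0)"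
  define u2 where "u2 = (\<lambda>t::real. if k = 2 then r else 0)"
  have \<gamma>: "\<gamma> t j = x j + (t - a) * r * filiform_X n k x j" for t j
    by (simp add: \<gamma>_def filiform_mult_axis [OF assms(1) k])
  have lip: "\<bar>r * filiform_X n k x j\<bar>-lipschitz_on {a..a + 1} (\<lambda>t. \<gamma> t j)" for j
  proof (rule lipschitz_onI)
    fix s t
    have "\<gamma> s j - \<gamma> t j = (r * filiform_X n k x j) * (s - t)"
      by (simp add: \<gamma> algebra_simps)
    then show "dist (\<gamma> s j) (\<gamma> t j) \<le> \<bar>r * filiform_X n k x j\<bar> * dist s t"
      by (simp add: dist_real_def abs_mult)
  qed simp
  have "horizontal_curve n a (a + 1) \<gamma> u1 u2"
    unfolding horizontal_curve_def
  proof (intro conjI ballI allI AE_I2)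
    show "\<gamma> t \<in> carrier (filiform n)" for t
      unfolding \<gamma>_def using assms(3) by (simp add: filiform_mult_closed)
    show "absolutely_continuous_on a (a + 1) (\<lambda>t. \<gamma> t j)" for j
      using lip by (rule lipschitz_imp_absolutely_continuous_on)
    show "u1 absolutely_integrable_on {a..a + 1}" "u2 absolutely_integrable_on {a..a + 1}"
      unfolding u1_def u2_def by (intro absolutely_integrable_on_const; simp)+
    fix t j
    have "filiform_X n k (\<gamma> t) = filiform_X n k x"
      unfolding \<gamma>_def using assms(1) k by (rule filiform_X_mult_axis)
    then have "u1 t * filiform_X n 1 (\<gamma> t) j + u2 t * filiform_X n 2 (\<gamma> t) j = r * filiform_X n k x j"
      using assms(2) by (auto simp: u1_def u2_def)
    moreover have "((\<lambda>s. \<gamma> s j) has_real_derivative r * filiform_X n k x j) (at t within {a..a + 1})"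
      unfolding \<gamma> by (rule derivative_eq_intros refl | simp)+
    ultimately show "((\<lambda>s. \<gamma> s j) has_real_derivative
        u1 t * filiform_X n 1 (\<gamma> t) j + u2 t * filiform_X n 2 (\<gamma> t) j) (at t within {a..a + 1})"
      by simp
  qed
  moreover have "\<gamma> a = x" "\<gamma> (a + 1) = filiform_mult n x (filiform_axis k r)"
    by (simp add: \<gamma> fun_eq_iff) (simp add: \<gamma>_def)
  moreover have "control_length a (a + 1) u1 u2 = \<bar>r\<bar>"
  proof -
    have "(\<lambda>t. sqrt ((u1 t)\<^sup>2 + (u2 t)\<^sup>2)) = (\<lambda>t. \<bar>r\<bar>)"
      using assms(2) by (auto simp: u1_def u2_def)
    then show ?thesis by (simp add: control_length_def)
  qed
  ultimately show "lipschitz_joined n a (a + 1) x (filiform_mult n x (filiform_axis k r)) \<bar>r\<bar>"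
    unfolding lipschitz_joined_def
    using lip by (intro conjI exI [of _ \<gamma>] exI [of _ u1] exI [of _ u2]) auto
qed

lemma absolutely_integrable_on_concat:
  fixes f g :: "real \<Rightarrow> real"
  assumes "a \<le> b" "b \<le> c" and f: "f absolutely_integrable_on {a..b}" and g: "g absolutely_integrable_on {b..c}"
  shows "(\<lambda>t. if t \<le> b then f t else g t) absolutely_integrable_on {a..c}"
proof -
  have "(\<lambda>t. if t \<le> b then f t else g t) absolutely_integrable_on {a..b} \<union> {b..c}"
  proof (rule set_integrable_Un)
    show "(\<lambda>t. if t \<le> b then f t else g t) absolutely_integrable_on {a..b}"
      using f by (rule absolutely_integrable_spike [where S = "{}"]) auto
    show "(\<lambda>t. if t \<le> b then f t else g t) absolutely_integrable_on {b..c}"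
      using g by (rule absolutely_integrable_spike [where S = "{b}"]) auto
  qed auto
  moreover have "{a..b} \<union> {b..c} = {a..c}" using assms(1,2) by auto
  ultimately show ?thesis by simp
qed

text \<open>
  Differentiability may fail at the junction \<open>b\<close>, which is a null set; at any other time the
  derivative within the long interval is the one within the part that contains this time.
\<close>

lemma lipschitz_joined_trans:
  assumes "lipschitz_joined n a b x y l" "lipschitz_joined n b c y z m"
  shows "lipschitz_joined n a c x z (l + m)"
proof -
  have "a < b" "b < c" using assms by (auto simp: lipschitz_joined_def)
  obtain \<gamma> u1 u2 where h1: "horizontal_curve n a b \<gamma> u1 u2"
    and lip1: "\<And>j. \<exists>K. K-lipschitz_on {a..b} (\<lambda>t. \<gamma> t j)"
    and e1: "\<gamma> a = x" "\<gamma> b = y" "control_length a b u1 u2 = l"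
    using assms(1) unfolding lipschitz_joined_def by blast
  obtain \<eta> v1 v2 where h2: "horizontal_curve n b c \<eta> v1 v2"
    and lip2: "\<And>j. \<exists>K. K-lipschitz_on {b..c} (\<lambda>t. \<eta> t j)"
    and e2: "\<eta> b = y" "\<eta> c = z" "control_length b c v1 v2 = m"
    using assms(2) unfolding lipschitz_joined_def by blast
  define \<zeta> where "\<zeta> t = (if t \<le> b then \<gamma> t else \<eta> t)" for t
  define w1 where "w1 t = (if t \<le> b then u1 t else v1 t)" for t
  define w2 where "w2 t = (if t \<le> b then u2 t else v2 t)" for t
  have \<zeta>_right: "\<zeta> t = \<eta> t" if "b \<le> t" for t
    using that e1 e2 by (auto simp: \<zeta>_def)
  have lip: "\<exists>K. K-lipschitz_on {a..c} (\<lambda>t. \<zeta> t j)" for j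
  proof -
    obtain K1 K2 where "K1-lipschitz_on {a..b} (\<lambda>t. \<gamma> t j)" "K2-lipschitz_on {b..c} (\<lambda>t. \<eta> t j)"
      using lip1 lip2 by blast
    then have "(max K1 K2)-lipschitz_on {a..c} (\<lambda>t. if t \<le> b then \<gamma> t j else \<eta> t j)"
      using e1 e2 by (intro lipschitz_on_concat_max) auto
    moreover have "(\<lambda>t. if t \<le> b then \<gamma> t j else \<eta> t j) = (\<lambda>t. \<zeta> t j)"
      by (auto simp: \<zeta>_def)
    ultimately show ?thesis by metis
  qed
  have "horizontal_curve n a c \<zeta> w1 w2"
    unfolding horizontal_curve_def
  proof (intro conjI ballI allI)
    show "\<zeta> t \<in> carrier (filiform n)" if "t \<in> {a..c}" for t
      using h1 h2 that unfolding horizontal_curve_def \<zeta>_def by auto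
    show "absolutely_continuous_on a c (\<lambda>t. \<zeta> t j)" for j
      using lip lipschitz_imp_absolutely_continuous_on by blast
    show "w1 absolutely_integrable_on {a..c}" "w2 absolutely_integrable_on {a..c}"
      using h1 h2 \<open>a < b\<close> \<open>b < c\<close> unfolding horizontal_curve_def w1_def w2_def
      by (auto intro!: absolutely_integrable_on_concat)
    have "AE t in lebesgue. t \<in> {a..b} \<longrightarrow> (\<forall>j. ((\<lambda>s. \<gamma> s j) has_real_derivative
        u1 t * filiform_X n 1 (\<gamma> t) j + u2 t * filiform_X n 2 (\<gamma> t) j) (at t within {a..b}))"
      using h1 unfolding horizontal_curve_def by (subst (asm) AE_restrict_space_iff) auto
    moreover have "AE t in lebesgue. t \<in> {b..c} \<longrightarrow> (\<forall>j. ((\<lambda>s. \<eta> s j) has_real_derivative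
        v1 t * filiform_X n 1 (\<eta> t) j + v2 t * filiform_X n 2 (\<eta> t) j) (at t within {b..c}))"
      using h2 unfolding horizontal_curve_def by (subst (asm) AE_restrict_space_iff) auto
    moreover have "AE t in lebesgue. t \<noteq> b"
      using AE_lborel_singleton [of b] by (rule AE_completion)
    ultimately have "AE t in lebesgue. t \<in> {a..c} \<longrightarrow> (\<forall>j. ((\<lambda>s. \<zeta> s j) has_real_derivative
        w1 t * filiform_X n 1 (\<zeta> t) j + w2 t * filiform_X n 2 (\<zeta> t) j) (at t within {a..c}))"
    proof eventually_elim
      case (elim t)
      show ?case
      proof (intro impI allI)
        fix j assume t: "t \<in> {a..c}"
        show "((\<lambda>s. \<zeta> s j) has_real_derivative
          w1 t * filiform_X n 1 (\<zeta> t) j + w2 t * filiform_X n 2 (\<zeta> t) j) (at t within {a..c})"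
        proof (cases "t < b")
          case True
          then have "((\<lambda>s. \<gamma> s j) has_real_derivative
              w1 t * filiform_X n 1 (\<zeta> t) j + w2 t * filiform_X n 2 (\<zeta> t) j) (at t within {a..b})"
            using elim(1) t by (simp add: \<zeta>_def w1_def w2_def)
          then have "((\<lambda>s. \<zeta> s j) has_real_derivative
              w1 t * filiform_X n 1 (\<zeta> t) j + w2 t * filiform_X n 2 (\<zeta> t) j) (at t within {a..b})"
            by (rule has_field_derivative_transform_within [OF _ zero_less_one])
              (use t True in \<open>auto simp: \<zeta>_def\<close>)
          moreover have "at t within {a..b} = at t within {a..c}"
            using True \<open>b < c\<close> by (intro at_within_nhd [of _ "{..<b}"]) auto
          ultimately show ?thesis by simp
        next
          case False
          then have "b < t" using elim(3) by simp
          then have "((\<lambda>s. \<eta> s j) has_real_derivative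
              w1 t * filiform_X n 1 (\<zeta> t) j + w2 t * filiform_X n 2 (\<zeta> t) j) (at t within {b..c})"
            using elim(2) t by (simp add: \<zeta>_def w1_def w2_def)
          then have "((\<lambda>s. \<zeta> s j) has_real_derivative
              w1 t * filiform_X n 1 (\<zeta> t) j + w2 t * filiform_X n 2 (\<zeta> t) j) (at t within {b..c})"
            by (rule has_field_derivative_transform_within [OF _ zero_less_one])
              (use t \<open>b < t\<close> in \<open>auto simp: \<zeta>_right\<close>)
          moreover have "at t within {b..c} = at t within {a..c}"
            using \<open>b < t\<close> \<open>a < b\<close> by (intro at_within_nhd [of _ "{b<..}"]) auto
          ultimately show ?thesis by simp
        qed
      qed
    qed
    then show "AE t in lebesgue_on {a..c}. \<forall>j. ((\<lambda>s. \<zeta> s j) has_real_derivative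
        w1 t * filiform_X n 1 (\<zeta> t) j + w2 t * filiform_X n 2 (\<zeta> t) j) (at t within {a..c})"
      by (subst AE_restrict_space_iff) auto
  qed
  moreover from this have "control_length a c w1 w2 = l + m"
  proof -
    let ?w = "\<lambda>t. sqrt ((w1 t)\<^sup>2 + (w2 t)\<^sup>2)"
    have "control_length a c w1 w2 = integral {a..b} ?w + integral {b..c} ?w"
      unfolding control_length_def using \<open>a < b\<close> \<open>b < c\<close>
        control_length_integrable [OF \<open>horizontal_curve n a c \<zeta> w1 w2\<close>]
      by (intro Henstock_Kurzweil_Integration.integral_combine [symmetric]) auto
    also have "integral {a..b} ?w = l"
      unfolding e1(3) [symmetric] control_length_def
      by (rule integral_cong) (simp add: w1_def w2_def)
    also have "integral {b..c} ?w = m"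
      unfolding e2(3) [symmetric] control_length_def
      by (rule integral_spike [of "{b}"]) (auto simp: w1_def w2_def)
    finally show ?thesis .
  qed
  moreover have "\<zeta> a = x" "\<zeta> c = z"
    using e1 e2 \<open>a < b\<close> \<open>b < c\<close> by (auto simp: \<zeta>_def)
  ultimately show ?thesis
    unfolding lipschitz_joined_def using lip \<open>a < b\<close> \<open>b < c\<close> by (intro conjI exI [of _ \<zeta>] exI [of _ w1] exI [of _ w2]) auto
qed

lemma cc_dist_le:
  assumes "lipschitz_joined n a b x y l"
  shows "cc_dist n x y \<le> l"
  unfolding cc_dist_def
proof (rule cInf_lower)
  show "l \<in> {control_length a b u1 u2 | a b \<gamma> u1 u2.
     a < b \<and> horizontal_curve n a b \<gamma> u1 u2 \<and> \<gamma> a = x \<and> \<gamma> b = y}"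
    using assms unfolding lipschitz_joined_def by blast
  show "bdd_below {control_length a b u1 u2 | a b \<gamma> u1 u2.
     a < b \<and> horizontal_curve n a b \<gamma> u1 u2 \<and> \<gamma> a = x \<and> \<gamma> b = y}"
  proof (rule bdd_belowI [of _ 0])
    fix l assume "l \<in> {control_length a b u1 u2 | a b \<gamma> u1 u2.
       a < b \<and> horizontal_curve n a b \<gamma> u1 u2 \<and> \<gamma> a = x \<and> \<gamma> b = y}"
    then obtain a b \<gamma> u1 u2 where l: "l = control_length a b u1 u2" and h: "horizontal_curve n a b \<gamma> u1 u2"
      by blast
    show "0 \<le> l" unfolding l control_length_def
      by (rule integral_nonneg [OF control_length_integrable [OF h]]) simp
  qed
qed

text \<open>
  The first assumption makes the set of lengths nonempty; without a curve from \<open>x\<close> to \<open>y\<close> the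
  infimum would be an unspecified real number.
\<close>

lemma cc_dist_ge:
  assumes "lipschitz_joined n a b x y l"
    and le: "\<And>a b \<gamma> u1 u2. a < b \<Longrightarrow> horizontal_curve n a b \<gamma> u1 u2 \<Longrightarrow> \<gamma> a = x \<Longrightarrow> \<gamma> b = y \<Longrightarrow>
      m \<le> control_length a b u1 u2"
  shows "m \<le> cc_dist n x y"
  unfolding cc_dist_def
proof (rule cInf_greatest)
  show "{control_length a b u1 u2 | a b \<gamma> u1 u2.
     a < b \<and> horizontal_curve n a b \<gamma> u1 u2 \<and> \<gamma> a = x \<and> \<gamma> b = y} \<noteq> {}"
    using assms(1) unfolding lipschitz_joined_def by blast
qed (use le in blast)


section \<open>Points reached from \<open>exp (X\<^sub>2)\<close> along a commutator\<close>

text \<open>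
  \<open>exp (X\<^sub>2)\<close> times the commutator of \<open>exp (t X\<^sub>1)\<close> and \<open>exp (- t X\<^sub>2)\<close>.  All of the movement in
  direction \<open>- X\<^sub>2\<close> takes place where the first coordinate is \<open>t\<close>, all of the compensating movement
  where it is 0; for \<open>t > 0\<close> this makes the fourth coordinate, the integral of \<open>u\<^sub>2 x\<^sub>1\<^sup>2 / 2\<close>, negative.
\<close>

definition commutator_point :: "nat \<Rightarrow> real \<Rightarrow> nat \<Rightarrow> real" where
  "commutator_point n t =
     filiform_mult n (filiform_mult n (filiform_mult n (filiform_mult n (unit_coord 2)
       (filiform_axis 1 t)) (filiform_axis 2 (- t))) (filiform_axis 1 (- t))) (filiform_axis 2 t)"

lemma unit_coord_in_filiform_coords: "k \<in> {1..n} \<Longrightarrow> unit_coord k \<in> filiform_coords n"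
  by (auto simp: filiform_coords_def unit_coord_def)

lemma filiform_exp_unit_coord_2:
  assumes "2 \<le> n"
  shows "filiform_exp n (unit_coord 2) = unit_coord 2"
proof
  fix j
  have "(\<Sum>k=2..j. unit_coord 2 k * ((- unit_coord 2 1) ^ (j - k) / fact (j - k + 1)))
      = unit_coord 2 j" if "2 \<le> j"
  proof -
    have "(\<Sum>k=2..j. unit_coord 2 k * ((- unit_coord 2 1) ^ (j - k) / fact (j - k + 1)))
        = (\<Sum>k=2..j. if k = j then unit_coord 2 k else 0)"
      by (intro sum.cong) (auto simp: unit_coord_def power_0_left)
    then show ?thesis using that by simp
  qed
  then show "filiform_exp n (unit_coord 2) j = unit_coord 2 j"
    using assms by (auto simp: filiform_exp_formula unit_coord_def)
qed

lemma commutator_point_coords: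
  assumes "2 \<le> n"
  shows "commutator_point n t j =
    (if 2 \<le> j \<and> j \<le> n then (- t) ^ (j - 1) / fact (j - 2) else 0) + (1 + t) * unit_coord 2 j"
proof -
  have k: "1 \<in> {1..n}" "2 \<in> {1..n}" using assms by auto
  define x1 where "x1 = filiform_mult n (unit_coord 2) (filiform_axis 1 t)"
  define x2 where "x2 = filiform_mult n x1 (filiform_axis 2 (- t))"
  define x3 where "x3 = filiform_mult n x2 (filiform_axis 1 (- t))"
  have closed: "x1 \<in> filiform_coords n" "x2 \<in> filiform_coords n" "x3 \<in> filiform_coords n"
    unfolding x1_def x2_def x3_def using assms by (auto intro!: filiform_mult_closed)
  have x1: "x1 j = unit_coord 2 j + t * unit_coord 1 j" for j
    unfolding x1_def by (subst filiform_mult_axis [OF unit_coord_in_filiform_coords [OF k(2)] k(1)])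
      (simp only: filiform_X_one)
  have x2: "x2 j = x1 j + (- t) * filiform_X n 2 x1 j" for j
    unfolding x2_def by (subst filiform_mult_axis [OF closed(1) k(2)]) simp
  have x3: "x3 j = x2 j + (- t) * unit_coord 1 j" for j
    unfolding x3_def by (subst filiform_mult_axis [OF closed(2) k(1)]) (simp only: filiform_X_one)
  have "x1 1 = t" "x3 1 = 0"
    by (simp_all add: x1 x2 x3 filiform_X_formula unit_coord_def)
  have "commutator_point n t j = x3 j + t * filiform_X n 2 x3 j"
    unfolding commutator_point_def x1_def [symmetric] x2_def [symmetric] x3_def [symmetric]
    by (subst filiform_mult_axis [OF closed(3) k(2)]) simp
  moreover have "filiform_X n 2 x3 j = unit_coord 2 j"
    unfolding filiform_X_formula [OF order_refl] \<open>x3 1 = 0\<close>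
    using assms by (auto simp: unit_coord_def power_0_left)
  moreover have "(- t) * filiform_X n 2 x1 j =
      (if 2 \<le> j \<and> j \<le> n then (- t) ^ (j - 1) / fact (j - 2) else 0)"
  proof (cases "2 \<le> j")
    case True
    then have "j - 1 = Suc (j - 2)" by simp
    then show ?thesis unfolding filiform_X_formula [OF order_refl] \<open>x1 1 = t\<close> by simp
  qed (simp add: filiform_X_formula)
  ultimately show ?thesis
    by (simp add: x3 x2 x1 algebra_simps)
qed

text \<open>
  From \<open>exp (X\<^sub>2)\<close> to the point one follows the four factors of the commutator; from the point to
  the identity one goes back along them and then along the segment from \<open>exp (X\<^sub>2)\<close>.
\<close>

lemma commutator_point_joined:
  assumes "2 \<le> n" "0 < t"
  shows "lipschitz_joined n 0 4 (unit_coord 2) (commutator_point n t) (4 * t)"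
    and "lipschitz_joined n 0 5 (commutator_point n t) (\<lambda>_. 0) (4 * t + 1)"
proof -
  have k: "1 \<in> {1..n}" "2 \<in> {1..n}" using assms by auto
  define p where "p = (unit_coord 2 :: nat \<Rightarrow> real)"
  define x1 where "x1 = filiform_mult n p (filiform_axis 1 t)"
  define x2 where "x2 = filiform_mult n x1 (filiform_axis 2 (- t))"
  define x3 where "x3 = filiform_mult n x2 (filiform_axis 1 (- t))"
  define x4 where "x4 = filiform_mult n x3 (filiform_axis 2 t)"
  have closed: "p \<in> filiform_coords n" "x1 \<in> filiform_coords n" "x2 \<in> filiform_coords n"
      "x3 \<in> filiform_coords n" "x4 \<in> filiform_coords n"
    unfolding p_def x1_def x2_def x3_def x4_def using assms
    by (auto intro!: filiform_mult_closed unit_coord_in_filiform_coords)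
  have x4: "commutator_point n t = x4"
    unfolding commutator_point_def x4_def x3_def x2_def x1_def p_def ..
  note segment = lipschitz_joined_axis [OF _ _ assms(1)]
  have "lipschitz_joined n 0 1 p x1 \<bar>t\<bar>" "lipschitz_joined n 1 2 x1 x2 \<bar>- t\<bar>"
      "lipschitz_joined n 2 3 x2 x3 \<bar>- t\<bar>" "lipschitz_joined n 3 4 x3 x4 \<bar>t\<bar>"
    by (rule segment [OF closed(1) _ _ x1_def] segment [OF closed(2) _ _ x2_def]
        segment [OF closed(3) _ _ x3_def] segment [OF closed(4) _ _ x4_def]; simp)+
  then have "lipschitz_joined n 0 4 p x4 (\<bar>t\<bar> + \<bar>- t\<bar> + \<bar>- t\<bar> + \<bar>t\<bar>)"
    by (blast intro: lipschitz_joined_trans)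
  then show "lipschitz_joined n 0 4 (unit_coord 2) (commutator_point n t) (4 * t)"
    unfolding x4 p_def using assms(2) by simp
  have "p = filiform_mult n (\<lambda>_. 0) (filiform_axis 2 1)"
    by (subst filiform_mult_axis [OF _ k(2)])
      (use assms in \<open>auto simp: p_def filiform_coords_def filiform_X_formula unit_coord_def power_0_left\<close>)
  then have reverse: "x3 = filiform_mult n x4 (filiform_axis 2 (- t))"
      "x2 = filiform_mult n x3 (filiform_axis 1 t)"
      "x1 = filiform_mult n x2 (filiform_axis 2 t)"
      "p = filiform_mult n x1 (filiform_axis 1 (- t))"
      "(\<lambda>_. 0) = filiform_mult n p (filiform_axis 2 (- 1))"
    using filiform_mult_axis_cancel [OF closed(4) k(2), of t]
      filiform_mult_axis_cancel [OF closed(3) k(1), of "- t"]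
      filiform_mult_axis_cancel [OF closed(2) k(2), of "- t"]
      filiform_mult_axis_cancel [OF closed(1) k(1), of t]
      filiform_mult_axis_cancel [of "\<lambda>_. 0" n 2 1] k(2)
    by (simp_all add: x4_def x3_def x2_def x1_def filiform_coords_def)
  have "lipschitz_joined n 0 1 x4 x3 \<bar>- t\<bar>" "lipschitz_joined n 1 2 x3 x2 \<bar>t\<bar>"
      "lipschitz_joined n 2 3 x2 x1 \<bar>t\<bar>" "lipschitz_joined n 3 4 x1 p \<bar>- t\<bar>"
      "lipschitz_joined n 4 5 p (\<lambda>_. 0) \<bar>- 1\<bar>"
    by (rule segment [OF closed(5) _ _ reverse(1)] segment [OF closed(4) _ _ reverse(2)]
        segment [OF closed(3) _ _ reverse(3)] segment [OF closed(2) _ _ reverse(4)]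
        segment [OF closed(1) _ _ reverse(5)]; simp)+
  then have "lipschitz_joined n 0 5 x4 (\<lambda>_. 0) (\<bar>- t\<bar> + \<bar>t\<bar> + \<bar>t\<bar> + \<bar>- t\<bar> + \<bar>- 1\<bar>)"
    by (blast intro: lipschitz_joined_trans)
  then show "lipschitz_joined n 0 5 (commutator_point n t) (\<lambda>_. 0) (4 * t + 1)"
    unfolding x4 using assms(2) by simp
qed

lemma cc_dist_unit_coord_2_le:
  assumes "2 \<le> n"
  shows "cc_dist n (unit_coord 2) (\<lambda>_. 0) \<le> 1"
proof -
  have k: "2 \<in> {1..n}" using assms by auto
  have "(\<lambda>_. 0) = filiform_mult n (unit_coord 2) (filiform_axis 2 (- 1))"
    by (subst filiform_mult_axis [OF unit_coord_in_filiform_coords [OF k] k])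
      (use assms in \<open>auto simp: fun_eq_iff filiform_X_formula unit_coord_def power_0_left\<close>)
  then have "lipschitz_joined n 0 1 (unit_coord 2) (\<lambda>_. 0) \<bar>- 1\<bar>"
    by (intro lipschitz_joined_axis [OF unit_coord_in_filiform_coords [OF k] _ assms]) auto
  then show ?thesis using cc_dist_le by fastforce
qed

text \<open>
  Both lower bounds come from the length estimate, with opposite signs \<open>\<sigma>\<close>: on the way from
  \<open>exp (X\<^sub>2)\<close> the fourth coordinate has to decrease while the second returns to its value, and on
  the way to the identity the fourth has to increase while the second decreases by 1.  The first
  bound keeps the denominator of the difference quotient away from the value 0.
\<close>

lemma cc_dist_commutator_point:
  assumes "4 \<le> n" "0 < t"
  shows "t / 3 \<le> cc_dist n (unit_coord 2) (commutator_point n t)"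
    and "cc_dist n (unit_coord 2) (commutator_point n t) \<le> 4 * t"
    and "1 + t / 3 \<le> cc_dist n (commutator_point n t) (\<lambda>_. 0)"
proof -
  have n: "2 \<le> n" using assms by simp
  have c: "commutator_point n t 1 = 0" "commutator_point n t 2 = 1"
    "commutator_point n t 4 = - (t ^ 3) / 2"
    using assms by (simp_all add: commutator_point_coords [OF n] unit_coord_def)
  note joined = commutator_point_joined [OF n assms(2)]
  show "cc_dist n (unit_coord 2) (commutator_point n t) \<le> 4 * t"
    by (rule cc_dist_le [OF joined(1)])
  show "t / 3 \<le> cc_dist n (unit_coord 2) (commutator_point n t)"
  proof (rule cc_dist_ge [OF joined(1)])
    fix a b :: real and \<gamma> u1 u2
    assume "a < b" "horizontal_curve n a b \<gamma> u1 u2" "\<gamma> a = unit_coord 2" "\<gamma> b = commutator_point n t"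
    then show "t / 3 \<le> control_length a b u1 u2"
      using horizontal_curve_length_ge [of n a b \<gamma> u1 u2 1 t] assms c by (simp add: unit_coord_def)
  qed
  show "1 + t / 3 \<le> cc_dist n (commutator_point n t) (\<lambda>_. 0)"
  proof (rule cc_dist_ge [OF joined(2)])
    fix a b :: real and \<gamma> u1 u2
    assume "a < b" "horizontal_curve n a b \<gamma> u1 u2" "\<gamma> a = commutator_point n t" "\<gamma> b = (\<lambda>_. 0)"
    then show "1 + t / 3 \<le> control_length a b u1 u2"
      using horizontal_curve_length_ge [of n a b \<gamma> u1 u2 "- 1" t] assms c by simp
  qed
qed

lemma commutator_point_tendsto:
  assumes "4 \<le> n"
  shows "filterlim (commutator_point n) (at (unit_coord 2) within filiform_coords n) (at_right 0)"
  unfolding filterlim_at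
proof
  have n: "2 \<le> n" using assms by simp
  have "commutator_point n t \<in> filiform_coords n" for t
    unfolding commutator_point_def using assms by (intro filiform_mult_closed) simp
  moreover have "commutator_point n t \<noteq> unit_coord 2" if "0 < t" for t
  proof
    assume "commutator_point n t = unit_coord 2"
    from fun_cong [OF this, of 4] show False
      using assms that by (simp add: commutator_point_coords [OF n] unit_coord_def)
  qed
  ultimately show "\<forall>\<^sub>F t in at_right 0.
      commutator_point n t \<in> filiform_coords n \<and> commutator_point n t \<noteq> unit_coord 2"
    by (auto simp: eventually_at_filter)
  have "continuous_on UNIV (commutator_point n)"
  proof (rule continuous_on_coordinatewise_then_product)
    show "continuous_on UNIV (\<lambda>t. commutator_point n t j)" for j
      unfolding commutator_point_coords [OF n]
      by (cases "2 \<le> j \<and> j \<le> n") (auto intro!: continuous_intros)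
  qed
  then have "isCont (commutator_point n) 0"
    by (simp add: continuous_on_eq_continuous_at)
  then have "(commutator_point n \<longlongrightarrow> commutator_point n 0) (at_right 0)"
    unfolding isCont_def by (rule tendsto_within_subset) simp
  moreover have "commutator_point n 0 = unit_coord 2"
    by (auto simp: commutator_point_coords [OF n] unit_coord_def fun_eq_iff power_0_left)
  ultimately show "(commutator_point n \<longlongrightarrow> unit_coord 2) (at_right 0)" by simp
qed

text \<open>
  A homomorphism to an abelian group kills commutators.
\<close>

lemma filiform_linear_commutator_point:
  assumes L: "filiform_linear n L" and n: "2 \<le> n"
  shows "L (inv\<^bsub>filiform n\<^esub> (unit_coord 2) \<otimes>\<^bsub>filiform n\<^esub> commutator_point n t) = 0"
proof -
  interpret group "filiform n" using n by (intro filiform_group) simp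
  have k: "1 \<in> {1..n}" "2 \<in> {1..n}" using n by auto
  let ?p = "unit_coord 2 :: nat \<Rightarrow> real"
  have add: "L (filiform_mult n x y) = L x + L y"
    if "x \<in> filiform_coords n" "y \<in> filiform_coords n" for x y
    using L that by (simp add: filiform_linear_def)
  have p: "?p \<in> filiform_coords n" using k(2) by (rule unit_coord_in_filiform_coords)
  have closed: "filiform_mult n x y \<in> filiform_coords n" for x y
    using n by (intro filiform_mult_closed) simp
  have axis: "L (filiform_axis k (- r)) = - L (filiform_axis k r)" if "k \<in> {1..n}" for k r
    using arg_cong [OF filiform_mult_axis_cancel [OF p that, of r], of L]
    by (simp add: add p closed filiform_axis_closed [OF that])
  have inv_p: "inv\<^bsub>filiform n\<^esub> ?p \<in> filiform_coords n"
    using inv_closed [of ?p] p by simp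
  have "L (commutator_point n t) = L ?p"
    unfolding commutator_point_def using k n
    by (simp add: add p closed filiform_axis_closed axis)
  moreover have "commutator_point n t \<in> filiform_coords n"
    unfolding commutator_point_def by (rule closed)
  ultimately have "L (inv\<^bsub>filiform n\<^esub> ?p \<otimes>\<^bsub>filiform n\<^esub> commutator_point n t)
      = L (inv\<^bsub>filiform n\<^esub> ?p \<otimes>\<^bsub>filiform n\<^esub> ?p)"
    using inv_p p by (simp add: add)
  also have "\<dots> = L \<one>\<^bsub>filiform n\<^esub>"
    using l_inv [of ?p] p by simp
  also have "\<dots> = 0"
    using add [of "\<one>\<^bsub>filiform n\<^esub>" "\<one>\<^bsub>filiform n\<^esub>"] l_one [OF one_closed] one_closed by simp
  finally show ?thesis .
qed

theorem proposition3p3: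
  fixes n :: nat
  assumes "n \<ge> 4"
  shows "\<not> pansu_differentiable_at n (\<lambda>x. cc_dist n x \<one>\<^bsub>filiform n\<^esub>)
             (filiform_exp n (unit_coord 2))"
proof
  have n: "2 \<le> n" using assms by simp
  let ?p = "unit_coord 2 :: nat \<Rightarrow> real" and ?y = "commutator_point n"
  assume "pansu_differentiable_at n (\<lambda>x. cc_dist n x \<one>\<^bsub>filiform n\<^esub>) (filiform_exp n ?p)"
  then obtain L where L: "filiform_linear n L"
    and lim: "((\<lambda>y. \<bar>cc_dist n y (\<lambda>_. 0) - cc_dist n ?p (\<lambda>_. 0)
        - L (inv\<^bsub>filiform n\<^esub> ?p \<otimes>\<^bsub>filiform n\<^esub> y)\<bar> / cc_dist n ?p y) \<longlongrightarrow> 0)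
        (at ?p within filiform_coords n)"
    unfolding pansu_differentiable_at_def filiform_exp_unit_coord_2 [OF n] by auto
  have "((\<lambda>t. \<bar>cc_dist n (?y t) (\<lambda>_. 0) - cc_dist n ?p (\<lambda>_. 0)\<bar> / cc_dist n ?p (?y t)) \<longlongrightarrow> 0)
      (at_right 0)"
    using filterlim_compose [OF lim commutator_point_tendsto [OF assms]]
    by (simp only: filiform_linear_commutator_point [OF L n] diff_zero)
  moreover have "\<forall>\<^sub>F t in at_right 0. 1 / 12 \<le>
      \<bar>cc_dist n (?y t) (\<lambda>_. 0) - cc_dist n ?p (\<lambda>_. 0)\<bar> / cc_dist n ?p (?y t)"
  proof -
    have "1 / 12 \<le> \<bar>cc_dist n (?y t) (\<lambda>_. 0) - cc_dist n ?p (\<lambda>_. 0)\<bar> / cc_dist n ?p (?y t)"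
      if "0 < t" for t
    proof -
      note d = cc_dist_commutator_point [OF assms that]
      have "cc_dist n ?p (?y t) \<le> 12 * (t / 3)" using d(2) by simp
      also have "\<dots> \<le> 12 * \<bar>cc_dist n (?y t) (\<lambda>_. 0) - cc_dist n ?p (\<lambda>_. 0)\<bar>"
        using d(3) cc_dist_unit_coord_2_le [OF n]
        by (intro mult_left_mono order_trans [OF _ abs_ge_self]) linarith+
      finally show ?thesis using d(1) that by (simp add: le_divide_eq)
    qed
    then show ?thesis by (simp add: eventually_at_filter)
  qed
  ultimately have "(1 / 12 :: real) \<le> 0"
    by (rule tendsto_lowerbound) simp
  then show False by simp
qed

end
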